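(* Let $\sigma,\tau$ be two distinct permutation patterns of length four. Then $$\sum_{\pi \in \mathcal{S}_n(\sigma,\tau)}q^{\mathrm{desc}(\pi)}v^{\mathrm{first}(\pi)}=\sum_{e \in I_n(\geq,-,>)}q^{\mathrm{dist}(e)-1}v^{\mathrm{last}(e)}\quad\text{for all } n \geq 1$$ if and only if $\{\sigma,\tau\}$ is one of the pairs $\{1243,1324\}$, $\{1243,1342\}$, $\{1243,1423\}$, $\{1324,1342\}$, $\{1324,1423\}$, $\{1342,1423\}$.
   Context: A permutation $\pi=\pi_1\cdots\pi_n\in\mathcal{S}_n$ contains a pattern $\rho\in\mathcal{S}_m$ if some subsequence of $\pi$ is order-isomorphic to $\rho$; otherwise it avoids $\rho$. $\mathcal{S}_n(\sigma,\tau)$ is the set of permutations of $[n]$ avoiding both $\sigma$ and $\tau$. For a sequence $s=s_1\cdots s_n$, a descent is an index $i\in[n-1]$ with $s_i>s_{i+1}$; $\mathrm{desc}(s)$ is the number of descents, $\mathrm{first}(s)=s_1$, $\mathrm{last}(s)=s_n$. Here inversion sequences are written with positive entries: $I_n$ is the set of sequences $e=e_1\cdots e_n$ of integers with $1\le e_i\le i$ for all $i$, and $I_n(\geq,-,>)$ is the subset of those $e$ for which there are no indices $i<j<k$ with both $e_i\ge e_j$ and $e_i>e_k$. $\mathrm{dist}(e)$ is the number of distinct values appearing in $e$. *)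

theory Defs
  imports
    "HOL-Library.Sublist"
    "HOL-Combinatorics.Multiset_Permutations"
    "HOL-Computational_Algebra.Polynomial"
begin

(* A permutation of [n] is its one-line word: a list of naturals enumerating {1..n}
   without repetition. List positions are 0-based, entries are 1-based. *)

definition order_isomorphic :: "nat list \<Rightarrow> nat list \<Rightarrow> bool" where
  "order_isomorphic xs ys \<longleftrightarrow>
     length xs = length ys \<and>
     (\<forall>i < length xs. \<forall>j < length xs. xs ! i < xs ! j \<longleftrightarrow> ys ! i < ys ! j)"

definition contains_pattern :: "nat list \<Rightarrow> nat list \<Rightarrow> bool" where
  "contains_pattern \<pi> \<rho> \<longleftrightarrow> (\<exists>s. subseq s \<pi> \<and> order_isomorphic s \<rho>)"

definition avoiding_permutations :: "nat \<Rightarrow> nat list \<Rightarrow> nat list \<Rightarrow> nat list set" where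
  "avoiding_permutations n \<sigma> \<tau> =
     {\<pi> \<in> permutations_of_set {1..n}. \<not> contains_pattern \<pi> \<sigma> \<and> \<not> contains_pattern \<pi> \<tau>}"

definition desc :: "nat list \<Rightarrow> nat" where
  "desc s = card {i. Suc i < length s \<and> s ! i > s ! Suc i}"

(* The entry at 0-based position i is the (i+1)-st one, hence the bound Suc i. *)
definition inversion_sequences :: "nat \<Rightarrow> nat list set" where
  "inversion_sequences n = {e. length e = n \<and> (\<forall>i < n. 1 \<le> e ! i \<and> e ! i \<le> Suc i)}"

(* I_n(\<ge>,-,>): the relation between e_j and e_k is unconstrained. *)
definition avoiding_inversion_sequences :: "nat \<Rightarrow> nat list set" where
  "avoiding_inversion_sequences n =
     {e \<in> inversion_sequences n.
        \<not> (\<exists>i j k. i < j \<and> j < k \<and> k < n \<and> e ! i \<ge> e ! j \<and> e ! i > e ! k)}"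

definition dist_values :: "nat list \<Rightarrow> nat" where
  "dist_values e = card (set e)"

(* The two indeterminates of Z[v][q]: q is the outer variable, and v is the variable of
   the coefficient ring, embedded as a constant. *)
definition var_q :: "int poly poly" where
  "var_q = monom 1 1"

definition var_v :: "int poly poly" where
  "var_v = [:monom 1 1:]"

(* Finiteness of the index sets, so that the sums over them are genuine. *)

lemma finite_avoiding_permutations: "finite (avoiding_permutations n \<sigma> \<tau>)"
  by (simp add: avoiding_permutations_def)

lemma finite_inversion_sequences: "finite (inversion_sequences n)"
proof (rule finite_subset)
  show "inversion_sequences n \<subseteq> {e. set e \<subseteq> {1..n} \<and> length e = n}"
    by (fastforce simp: inversion_sequences_def in_set_conv_nth)
  show "finite {e. set e \<subseteq> {1..n} \<and> length e = n}"
    by (rule finite_lists_length_eq) simp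
qed

lemma finite_avoiding_inversion_sequences: "finite (avoiding_inversion_sequences n)"
  using finite_inversion_sequences by (simp add: avoiding_inversion_sequences_def)

end

theory Submission
  imports Defs
begin

text \<open>Both sides are shown to satisfy the same recurrence, \<open>catalytic\<close>, in the length and the marked
  (first or last) entry.

  Each of the four patterns is \<open>1\<close> followed by a pattern of length three, so a permutation is
  built by prepending first entries \<open>m\<close>, subject to the entries \<open>\<ge> m\<close> avoiding two patterns of
  length three. Consider the permutations whose first entry is at least \<open>m\<close> and whose entries \<open>\<ge> m\<close>
  avoid these patterns. The recurrence amounts to saying that every shorter permutation whose entries
  \<open>\<ge> m\<close> avoid them yields two of those, one of them with one more descent. For four pairs this is
  literal: exactly two values, one below and one above the first large entry, may be prepended. For
  the other two pairs the number of choices varies; there one fixes the word \<open>w\<close> of the large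
  entries and shows that the generating function depends only on the numbers of ascents and
  descents of \<open>w\<close> and obeys a linear relation. This rests on the fact that an avoiding word has
  exactly two avoiding extensions by a new minimum, one of them with one more descent.

  For inversion sequences one tracks in addition a bound on the maximum: if the last entry is not
  maximal, then the maximum is attained only just before it and can be deleted.

  Conversely, for \<open>n = 4\<close> the left side is the sum over all permutations minus the terms of
  \<open>\<sigma>\<close> and \<open>\<tau>\<close>, so both must have exactly one descent and begin with \<open>1\<close>.\<close>

subsection \<open>Inversion sequences\<close>

text \<open>Only triples ending in the new entry are new. They concern the pairs
  \<open>i < j < n\<close> with \<open>e ! j \<le> e ! i\<close>, and such an \<open>e ! i\<close>
  may not exceed any later entry.\<close>

lemma snoc_mem_avoiding_inversion_sequences:
  "e @ [m] \<in> avoiding_inversion_sequences (Suc n) \<longleftrightarrow>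
     e \<in> avoiding_inversion_sequences n \<and> 1 \<le> m \<and> m \<le> Suc n \<and>
     (\<forall>i j. i < j \<longrightarrow> j < n \<longrightarrow> e ! j \<le> e ! i \<longrightarrow> e ! i \<le> m)"
  (is "?L \<longleftrightarrow> ?R")
proof
  assume L: ?L
  then have len: "length e = n"
    by (simp add: avoiding_inversion_sequences_def inversion_sequences_def)
  have nth: "(e @ [m]) ! i = e ! i" if "i < n" for i
    using that len by (simp add: nth_append)
  have nthn: "(e @ [m]) ! n = m"
    using len by (simp add: nth_append)
  from L have range: "\<And>i. i < Suc n \<Longrightarrow> 1 \<le> (e @ [m]) ! i \<and> (e @ [m]) ! i \<le> Suc i"
    and av: "\<And>i j k. i < j \<Longrightarrow> j < k \<Longrightarrow> k < Suc n \<Longrightarrow>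
      (e @ [m]) ! j \<le> (e @ [m]) ! i \<Longrightarrow> (e @ [m]) ! i \<le> (e @ [m]) ! k"
    unfolding avoiding_inversion_sequences_def inversion_sequences_def mem_Collect_eq
    by (blast, meson not_less)
  show ?R
  proof (intro conjI allI impI)
    show "e \<in> avoiding_inversion_sequences n"
      unfolding avoiding_inversion_sequences_def inversion_sequences_def
    proof (intro CollectI conjI allI impI notI)
      show "length e = n" by (fact len)
      show "1 \<le> e ! i" "e ! i \<le> Suc i" if "i < n" for i
        using range[of i] nth that by auto
    next
      assume "\<exists>i j k. i < j \<and> j < k \<and> k < n \<and> e ! j \<le> e ! i \<and> e ! k < e ! i"
      then obtain i j k where "i < j" "j < k" "k < n" "e ! j \<le> e ! i" "e ! k < e ! i" by auto
      then show False using av[of i j k] nth by auto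
    qed
    show "1 \<le> m" "m \<le> Suc n" using range[of n] nthn by auto
    show "e ! i \<le> m" if "i < j" "j < n" "e ! j \<le> e ! i" for i j
      using av[of i j n] that nth nthn by auto
  qed
next
  assume R: ?R
  then have len: "length e = n"
    by (simp add: avoiding_inversion_sequences_def inversion_sequences_def)
  have nth: "(e @ [m]) ! i = (if i < n then e ! i else m)" if "i < Suc n" for i
    using that len by (auto simp: nth_append less_Suc_eq)
  from R have range: "\<And>i. i < n \<Longrightarrow> 1 \<le> e ! i \<and> e ! i \<le> Suc i"
    and av: "\<And>i j k. i < j \<Longrightarrow> j < k \<Longrightarrow> k < n \<Longrightarrow> e ! j \<le> e ! i \<Longrightarrow> e ! i \<le> e ! k"
    unfolding avoiding_inversion_sequences_def inversion_sequences_def mem_Collect_eq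
    by (blast, meson not_less)
  show ?L
    unfolding avoiding_inversion_sequences_def inversion_sequences_def
  proof (intro CollectI conjI allI impI notI)
    show "length (e @ [m]) = Suc n" using len by simp
    show "1 \<le> (e @ [m]) ! i" "(e @ [m]) ! i \<le> Suc i" if "i < Suc n" for i
      using range[of i] R that by (auto simp: nth less_Suc_eq)
  next
    assume "\<exists>i j k. i < j \<and> j < k \<and> k < Suc n \<and> (e @ [m]) ! j \<le> (e @ [m]) ! i \<and> (e @ [m]) ! k < (e @ [m]) ! i"
    then obtain i j k where ijk: "i < j" "j < k" "k < Suc n" "(e @ [m]) ! j \<le> (e @ [m]) ! i" "(e @ [m]) ! k < (e @ [m]) ! i" by auto
    then have *: "e ! j \<le> e ! i" "(e @ [m]) ! k < e ! i" "j < n"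
      using nth[of i] nth[of j] by auto
    show False
    proof (cases "k < n")
      case True
      then show False using av[of i j k] ijk * nth[of k] by auto
    next
      case False
      then show False using R ijk * nth[of k] by fastforce
    qed
  qed
qed

lemma length_avoiding_inversion_sequences:
  "e \<in> avoiding_inversion_sequences n \<Longrightarrow> length e = n"
  by (simp add: avoiding_inversion_sequences_def inversion_sequences_def)

lemma avoiding_inversion_sequences_bounds:
  assumes "e \<in> avoiding_inversion_sequences n" "x \<in> set e"
  shows "1 \<le> x" "x \<le> n"
  using assms
  by (force simp: avoiding_inversion_sequences_def inversion_sequences_def in_set_conv_nth)+

lemma avoiding_inversion_sequences_Suc_cases:
  assumes "e \<in> avoiding_inversion_sequences (Suc n)"
  obtains d where "e = d @ [last e]" "d \<in> avoiding_inversion_sequences n"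
proof (cases e rule: rev_cases)
  case Nil
  then show thesis using length_avoiding_inversion_sequences[OF assms] by simp
next
  case (snoc d m)
  then show thesis using assms snoc_mem_avoiding_inversion_sequences[of d m n] that by auto
qed

text \<open>A new weak maximum is never smaller than an earlier entry, so it cannot end a forbidden
  triple.\<close>

lemma snoc_ge_mem_avoiding_inversion_sequences:
  assumes "e \<in> avoiding_inversion_sequences n" "1 \<le> m" "m \<le> Suc n" "\<forall>x\<in>set e. x \<le> m"
  shows "e @ [m] \<in> avoiding_inversion_sequences (Suc n)"
  unfolding snoc_mem_avoiding_inversion_sequences
  using assms length_avoiding_inversion_sequences[OF assms(1)] by auto

text \<open>A copy of \<open>Suc f\<close> inside \<open>c\<close>, the one just before
  \<open>m\<close>, and the smaller \<open>m\<close> would form a forbidden triple. So the value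
  occurs once, and it can be deleted or inserted without changing the pairs that restrict
  \<open>m\<close>.\<close>

lemma avoiding_inversion_sequences_insert_max:
  assumes "m \<le> f" "f < n" "1 \<le> m" "length c = n - 1"
  shows "c @ [Suc f, m] \<in> avoiding_inversion_sequences (Suc n) \<and> (\<forall>x\<in>set c. x \<le> Suc f)
    \<longleftrightarrow> c @ [m] \<in> avoiding_inversion_sequences n \<and> (\<forall>x\<in>set c. x \<le> f)"
    (is "?L \<longleftrightarrow> ?R")
proof -
  obtain k where n: "n = Suc k" using assms by (cases n) auto
  have 1: "c @ [Suc f, m] = (c @ [Suc f]) @ [m]" by simp
  show ?thesis
  proof
    assume L: ?L
    then have L': "c @ [Suc f] \<in> avoiding_inversion_sequences n"
      and cond: "\<And>i j. i < j \<Longrightarrow> j < n \<Longrightarrow> (c @ [Suc f]) ! j \<le> (c @ [Suc f]) ! i \<Longrightarrow> (c @ [Suc f]) ! i \<le> m"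
      using assms unfolding 1 snoc_mem_avoiding_inversion_sequences by auto
    have lt: "c ! i \<le> f" if "i < k" for i
    proof (rule ccontr)
      assume "\<not> c ! i \<le> f"
      then have "c ! i = Suc f" using L that assms n by (force simp: le_Suc_eq)
      then show False using cond[of i k] that assms n by (auto simp: nth_append)
    qed
    have "c @ [m] \<in> avoiding_inversion_sequences (Suc k)"
      using L'[unfolded n snoc_mem_avoiding_inversion_sequences] assms n cond
      unfolding snoc_mem_avoiding_inversion_sequences
      by (auto simp: nth_append)
    moreover have "\<forall>x\<in>set c. x \<le> f" using lt assms n by (auto simp: in_set_conv_nth)
    ultimately show ?R using n by blast
  next
    assume R: ?R
    then have c: "c \<in> avoiding_inversion_sequences k" and le: "\<forall>x\<in>set c. x \<le> f"
      and cond: "\<And>i j. i < j \<Longrightarrow> j < k \<Longrightarrow> c ! j \<le> c ! i \<Longrightarrow> c ! i \<le> m"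
      using assms unfolding n snoc_mem_avoiding_inversion_sequences by auto
    have "c @ [Suc f] \<in> avoiding_inversion_sequences n"
      unfolding n using c le assms n by (intro snoc_ge_mem_avoiding_inversion_sequences) auto
    moreover have "(c @ [Suc f]) ! i \<le> m"
      if "i < j" "j < n" "(c @ [Suc f]) ! j \<le> (c @ [Suc f]) ! i" for i j
    proof (cases "j < k")
      case True
      then show ?thesis using that cond[of i j] assms n by (auto simp: nth_append)
    next
      case False
      then have "c ! i \<ge> Suc f" using that assms n by (auto simp: nth_append less_Suc_eq)
      moreover have "c ! i \<le> f" using le False that assms n by auto
      ultimately show ?thesis by simp
    qed
    ultimately show ?L
      using assms le unfolding 1 snoc_mem_avoiding_inversion_sequences by auto
  qed
qed

section \<open>Generating functions of inversion sequences by last entry, bound and maximum\<close>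

context
  fixes q :: "'a::comm_ring_1"
begin

text \<open>The bound \<open>f\<close> is the extra parameter in which deletion of the maximum
  becomes a recursion. For \<open>f = n\<close> it is void, and the value is the coefficient of
  \<open>v ^ m\<close> on the side of inversion sequences.\<close>

definition inv_last :: "nat \<Rightarrow> nat \<Rightarrow> nat \<Rightarrow> 'a" where
  "inv_last n m f =
     (\<Sum>e | e \<in> avoiding_inversion_sequences n \<and> last e = m \<and> (\<forall>x\<in>set e. x \<le> f). q ^ (dist_values e - 1))"

definition inv_max :: "nat \<Rightarrow> nat \<Rightarrow> 'a" where
  "inv_max n t =
     (\<Sum>e | e \<in> avoiding_inversion_sequences n \<and> t \<in> set e \<and> (\<forall>x\<in>set e. x \<le> t). q ^ (dist_values e - 1))"

text \<open>The sequences not bounded by \<open>f\<close> have maximum \<open>Suc f\<close>, which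
  is larger than the last entry and stands only just before it. Deleting it removes one position and
  one distinct value, hence the factor \<open>q\<close>.\<close>

lemma inv_last_Suc_Suc:
  assumes "1 \<le> m" "m \<le> f" "f < n"
  shows "inv_last (Suc n) m (Suc f) = inv_last (Suc n) m f + q * inv_last n m f"
proof -
  let ?A = "{e. e \<in> avoiding_inversion_sequences (Suc n) \<and> last e = m \<and> (\<forall>x\<in>set e. x \<le> Suc f)}"
  let ?B = "{e. e \<in> avoiding_inversion_sequences (Suc n) \<and> last e = m \<and> (\<forall>x\<in>set e. x \<le> f)}"
  let ?C = "{e. e \<in> avoiding_inversion_sequences n \<and> last e = m \<and> (\<forall>x\<in>set e. x \<le> f)}"
  obtain k where n: "n = Suc k" using assms by (cases n) auto
  have fin: "finite ?A" "finite ?B" "finite ?C"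
    using finite_avoiding_inversion_sequences by auto
  have sub: "?B \<subseteq> ?A" by auto
  have C_snoc: "e = butlast e @ [m]" "length (butlast e) = k" if "e \<in> ?C" for e
    using that length_avoiding_inversion_sequences[of e n] n
    by (auto simp: length_butlast intro!: append_butlast_last_id[symmetric])
  have "(\<Sum>e\<in>?A - ?B. q ^ (dist_values e - 1)) = (\<Sum>e\<in>?C. q * q ^ (dist_values e - 1))"
  proof (rule sum.reindex_bij_witness[of _ "\<lambda>e. butlast e @ [Suc f, m]" "\<lambda>e. take k e @ [m]"])
    fix e assume e: "e \<in> ?A - ?B"
    then obtain d where d: "e = d @ [m]" "d \<in> avoiding_inversion_sequences n"
      by (auto elim: avoiding_inversion_sequences_Suc_cases)
    then obtain c y where c: "d = c @ [y]" "c \<in> avoiding_inversion_sequences k"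
      by (auto simp: n elim: avoiding_inversion_sequences_Suc_cases)
    have len: "length c = k" using length_avoiding_inversion_sequences[OF c(2)] .
    have cond: "\<And>i j. i < j \<Longrightarrow> j < n \<Longrightarrow> d ! j \<le> d ! i \<Longrightarrow> d ! i \<le> m"
      using e d unfolding d(1) by (auto simp: snoc_mem_avoiding_inversion_sequences)
    have le: "\<forall>x\<in>set d. x \<le> Suc f" using e d by auto
    have "Suc f \<in> set d"
      using e d assms by (auto simp: le_Suc_eq)
    then obtain i where i: "i < n" "d ! i = Suc f" using d
      by (metis in_set_conv_nth length_avoiding_inversion_sequences)
    \<comment> \<open>An earlier occurrence of \<open>Suc f\<close> would be followed by
      \<open>d ! k \<le> Suc f\<close> and then by the smaller \<open>m\<close>.\<close>
    have "i = k"
    proof (rule ccontr)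
      assume "i \<noteq> k"
      then have "i < k" using i n by simp
      moreover have "d ! k \<le> Suc f" using le c len by auto
      ultimately show False using cond[of i k] i n assms by auto
    qed
    then have y: "y = Suc f" using i c len by (simp add: nth_append)
    then have ec: "e = c @ [Suc f, m]" using d c by simp
    have R: "c @ [m] \<in> avoiding_inversion_sequences n \<and> (\<forall>x\<in>set c. x \<le> f)"
      using avoiding_inversion_sequences_insert_max[of m f n c] e ec assms n len by auto
    show "take k e @ [m] \<in> ?C" using R ec len assms by auto
    show "butlast (take k e @ [m]) @ [Suc f, m] = e" using ec len by simp
    have "Suc f \<notin> set (c @ [m])" using R assms by force
    moreover have "set e = insert (Suc f) (set (c @ [m]))" unfolding ec by auto
    ultimately have "dist_values e = Suc (dist_values (c @ [m]))"
      unfolding dist_values_def by (metis List.finite_set card_insert_disjoint)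
    moreover have "dist_values (c @ [m]) \<noteq> 0" by (simp add: dist_values_def)
    ultimately show "q * q ^ (dist_values (take k e @ [m]) - 1) = q ^ (dist_values e - 1)"
      using ec len by (simp flip: power_Suc)
  next
    fix e assume e: "e \<in> ?C"
    from C_snoc[OF e] obtain c where c: "e = c @ [m]" "length c = k" by metis
    have "c @ [Suc f, m] \<in> avoiding_inversion_sequences (Suc n) \<and> (\<forall>x\<in>set c. x \<le> Suc f)"
      using avoiding_inversion_sequences_insert_max[of m f n c] e c assms n by auto
    then show "butlast e @ [Suc f, m] \<in> ?A - ?B" using c assms by auto
    show "take k (butlast e @ [Suc f, m]) @ [m] = e" using c by simp
  qed
  then have "sum (\<lambda>e. q ^ (dist_values e - 1)) (?A - ?B) = q * inv_last n m f"
    unfolding inv_last_def by (simp add: sum_distrib_left)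
  then show ?thesis
    using sum.subset_diff[OF sub fin(1), of "\<lambda>e. q ^ (dist_values e - 1)"]
    unfolding inv_last_def by simp
qed

text \<open>A last entry that bounds all others can be appended freely. It is a new value unless the
  prefix already has maximum \<open>m\<close>, so the prefixes are sorted by their maximum
  \<open>t\<close>.\<close>

lemma inv_last_diag:
  assumes "1 \<le> m" "m \<le> Suc n" "1 \<le> n"
  shows "inv_last (Suc n) m m = inv_max n m + q * (\<Sum>t = 1..<m. inv_max n t)"
proof -
  let ?I = "avoiding_inversion_sequences n"
  let ?A = "{e. e \<in> avoiding_inversion_sequences (Suc n) \<and> last e = m \<and> (\<forall>x\<in>set e. x \<le> m)}"
  let ?M = "\<lambda>t. {e. e \<in> ?I \<and> t \<in> set e \<and> (\<forall>x\<in>set e. x \<le> t)}"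
  let ?B = "\<Union>t\<in>{1..<m}. ?M t"
  have fin: "finite ?I" by (rule finite_avoiding_inversion_sequences)
  have ne: "e \<noteq> []" if "e \<in> ?I" for e
    using length_avoiding_inversion_sequences[OF that] assms by auto
  have split: "{e. e \<in> ?I \<and> (\<forall>x\<in>set e. x \<le> m)} = ?M m \<union> ?B"
  proof (intro equalityI subsetI)
    fix e assume e: "e \<in> {e. e \<in> ?I \<and> (\<forall>x\<in>set e. x \<le> m)}"
    then have mx: "Max (set e) \<in> set e" using ne[of e] by auto
    then have "1 \<le> Max (set e)" using avoiding_inversion_sequences_bounds e by auto
    moreover have "Max (set e) \<le> m" using e mx by auto
    moreover have "e \<in> ?M (Max (set e))" using e mx by auto
    ultimately show "e \<in> ?M m \<union> ?B" by (cases "Max (set e) = m") (auto simp: order_less_le)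
  next
    fix e assume "e \<in> ?M m \<union> ?B"
    then obtain t where "e \<in> ?M t" "t \<le> m" by auto
    then show "e \<in> {e. e \<in> ?I \<and> (\<forall>x\<in>set e. x \<le> m)}" by (auto intro: order.trans[of _ t])
  qed
  have "inv_last (Suc n) m m = (\<Sum>e | e \<in> ?I \<and> (\<forall>x\<in>set e. x \<le> m). q ^ (dist_values (e @ [m]) - 1))"
    unfolding inv_last_def
  proof (rule sum.reindex_bij_witness[of _ "\<lambda>e. e @ [m]" butlast])
    fix e assume e: "e \<in> ?A"
    then obtain d where d: "e = d @ [m]" "d \<in> ?I"
      by (auto elim: avoiding_inversion_sequences_Suc_cases)
    then show "butlast e @ [m] = e" "butlast e \<in> {e. e \<in> ?I \<and> (\<forall>x\<in>set e. x \<le> m)}"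
      "q ^ (dist_values (butlast e @ [m]) - 1) = q ^ (dist_values e - 1)" using e by auto
  next
    fix e assume "e \<in> {e. e \<in> ?I \<and> (\<forall>x\<in>set e. x \<le> m)}"
    then show "e @ [m] \<in> ?A" "butlast (e @ [m]) = e"
      using assms snoc_ge_mem_avoiding_inversion_sequences[of e n m] by auto
  qed
  also have "\<dots> = (\<Sum>e\<in>?M m. q ^ (dist_values (e @ [m]) - 1)) + (\<Sum>e\<in>?B. q ^ (dist_values (e @ [m]) - 1))"
    unfolding split using fin by (intro sum.union_disjoint) auto
  also have "(\<Sum>e\<in>?M m. q ^ (dist_values (e @ [m]) - 1)) = inv_max n m"
    unfolding inv_max_def by (intro sum.cong) (auto simp: dist_values_def insert_absorb)
  also have "(\<Sum>e\<in>?B. q ^ (dist_values (e @ [m]) - 1)) = (\<Sum>t = 1..<m. \<Sum>e\<in>?M t. q ^ (dist_values (e @ [m]) - 1))"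
    using fin by (intro sum.UNION_disjoint) (auto intro: antisym)
  also have "\<dots> = (\<Sum>t = 1..<m. \<Sum>e\<in>?M t. q * q ^ (dist_values e - 1))"
  proof (intro sum.cong refl)
    fix t e assume t: "t \<in> {1..<m}" and e: "e \<in> ?M t"
    then have "m \<notin> set e" by auto
    then have "dist_values (e @ [m]) = Suc (dist_values e)" by (simp add: dist_values_def)
    moreover have "dist_values e \<noteq> 0" using e ne[of e] by (auto simp: dist_values_def)
    ultimately show "q ^ (dist_values (e @ [m]) - 1) = q * q ^ (dist_values e - 1)"
      by (simp flip: power_Suc)
  qed
  also have "\<dots> = q * (\<Sum>t = 1..<m. inv_max n t)"
    unfolding inv_max_def by (simp add: sum_distrib_left)
  finally show ?thesis .
qed

text \<open>Double counting of the sequences with entries at most \<open>f\<close>, by last entry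
  and by maximum.\<close>

lemma sum_inv_last:
  assumes "1 \<le> n"
  shows "(\<Sum>h = 1..f. inv_last n h f) = (\<Sum>t = 1..f. inv_max n t)"
proof -
  let ?I = "avoiding_inversion_sequences n"
  let ?S = "{e. e \<in> ?I \<and> (\<forall>x\<in>set e. x \<le> f)}"
  let ?L = "\<lambda>m. {e. e \<in> ?I \<and> last e = m \<and> (\<forall>x\<in>set e. x \<le> f)}"
  let ?M = "\<lambda>t. {e. e \<in> ?I \<and> t \<in> set e \<and> (\<forall>x\<in>set e. x \<le> t)}"
  have fin: "finite ?I" by (rule finite_avoiding_inversion_sequences)
  have ne: "e \<noteq> []" if "e \<in> ?I" for e
    using length_avoiding_inversion_sequences[OF that] assms by auto
  have SL: "?S = (\<Union>h\<in>{1..f}. ?L h)"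
  proof (intro equalityI subsetI)
    fix e assume "e \<in> ?S"
    then show "e \<in> (\<Union>h\<in>{1..f}. ?L h)"
      using ne[of e] avoiding_inversion_sequences_bounds(1)[of e n "last e"] by auto
  qed auto
  have SM: "?S = (\<Union>t\<in>{1..f}. ?M t)"
  proof (intro equalityI subsetI)
    fix e assume e: "e \<in> ?S"
    then have mx: "Max (set e) \<in> set e" using ne[of e] by auto
    then have "1 \<le> Max (set e)" "Max (set e) \<le> f" using avoiding_inversion_sequences_bounds e by auto
    moreover have "e \<in> ?M (Max (set e))" using e mx by auto
    ultimately show "e \<in> (\<Union>t\<in>{1..f}. ?M t)" by auto
  next
    fix e assume "e \<in> (\<Union>t\<in>{1..f}. ?M t)"
    then obtain t where "e \<in> ?M t" "t \<le> f" by auto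
    then show "e \<in> ?S" by (auto intro: order.trans[of _ t])
  qed
  have "(\<Sum>h = 1..f. inv_last n h f) = (\<Sum>e\<in>?S. q ^ (dist_values e - 1))"
    unfolding inv_last_def SL using fin by (intro sum.UNION_disjoint[symmetric]) auto
  also have "\<dots> = (\<Sum>t = 1..f. inv_max n t)"
    unfolding inv_max_def SM using fin by (intro sum.UNION_disjoint) (auto intro: antisym)
  finally show ?thesis .
qed

text \<open>Summing the deletion recursion over the last entries below \<open>h\<close> and passing
  to sums over maxima isolates \<open>inv_max (Suc n) h\<close>. The remaining multiple of
  \<open>q\<close> is eliminated with \<open>inv_last_diag\<close>.\<close>

lemma inv_max_Suc:
  assumes "1 \<le> h" "h \<le> n"
  shows "inv_max (Suc n) h = 2 * inv_last (Suc n) h h - inv_max n h"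
proof -
  obtain g where h: "h = Suc g" using assms by (cases h) auto
  have "(\<Sum>m = 1..g. inv_last (Suc n) m (Suc g)) = (\<Sum>m = 1..g. inv_last (Suc n) m g + q * inv_last n m g)"
    using assms h by (intro sum.cong inv_last_Suc_Suc) auto
  also have "\<dots> = (\<Sum>t = 1..g. inv_max (Suc n) t) + q * (\<Sum>t = 1..g. inv_max n t)"
    using assms h sum_inv_last[of n g] sum_inv_last[of "Suc n" g]
    by (simp add: sum.distrib flip: sum_distrib_left)
  finally have "(\<Sum>t = 1..h. inv_max (Suc n) t) =
      (\<Sum>t = 1..g. inv_max (Suc n) t) + q * (\<Sum>t = 1..g. inv_max n t) + inv_last (Suc n) h h"
    using sum_inv_last[of "Suc n" h] h by (simp add: algebra_simps)
  then have "inv_max (Suc n) h = q * (\<Sum>t = 1..g. inv_max n t) + inv_last (Suc n) h h"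
    using h by simp
  moreover have "inv_last (Suc n) h h = inv_max n h + q * (\<Sum>t = 1..g. inv_max n t)"
    using inv_last_diag[of h n] assms h by (simp add: atLeastLessThanSuc_atLeastAtMost)
  ultimately show ?thesis by (simp add: algebra_simps)
qed

text \<open>Both sides obey the recursion \<open>inv_last_Suc_Suc\<close> in the bound, so the
  induction on \<open>f\<close> combines the instances for \<open>k\<close> and
  \<open>k - 1\<close>. The start \<open>f = m\<close> comes from \<open>inv_last_diag\<close> and
  \<open>inv_max_Suc\<close>.\<close>

lemma inv_last_rec:
  assumes "1 \<le> m" "m \<le> f" "f \<le> k"
  shows "inv_last (Suc (Suc k)) m (Suc f) = (1 + q) * inv_last (Suc k) m f +
    q * (\<Sum>h = 1..<m. inv_last (Suc k) h f + (1 - q) * inv_last k h (f - 1))"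
  using assms(2,1,3)
proof (induction f arbitrary: k rule: dec_induct)
  case base
  obtain l where m: "m = Suc l" using base by (cases m) auto
  \<comment> \<open>Expanding \<open>inv_last (Suc k) h m\<close> at the bound
    \<open>m = Suc l\<close> produces \<open>q * inv_last k h l\<close>, which the multiple by
    \<open>1 - q\<close> completes to \<open>inv_last k h l\<close>.\<close>
  have "(\<Sum>h = 1..<m. inv_last (Suc k) h m + (1 - q) * inv_last k h (m - 1)) =
      (\<Sum>h = 1..l. inv_last (Suc k) h l + inv_last k h l)"
    using base m by (intro sum.cong) (auto simp: inv_last_Suc_Suc algebra_simps)
  also have "\<dots> = (\<Sum>t = 1..<m. inv_max (Suc k) t) + (\<Sum>t = 1..<m. inv_max k t)"
    using base m sum_inv_last[of k l] sum_inv_last[of "Suc k" l]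
    by (simp add: sum.distrib atLeastLessThanSuc_atLeastAtMost)
  finally have 1: "(\<Sum>h = 1..<m. inv_last (Suc k) h m + (1 - q) * inv_last k h (m - 1)) =
     (\<Sum>t = 1..<m. inv_max (Suc k) t) + (\<Sum>t = 1..<m. inv_max k t)" .
  have "inv_last (Suc (Suc k)) m (Suc m) = inv_last (Suc (Suc k)) m m + q * inv_last (Suc k) m m"
    using base by (intro inv_last_Suc_Suc) auto
  also have "inv_last (Suc (Suc k)) m m = inv_max (Suc k) m + q * (\<Sum>t = 1..<m. inv_max (Suc k) t)"
    using base by (intro inv_last_diag) auto
  also have "inv_max (Suc k) m = 2 * inv_last (Suc k) m m - inv_max k m"
    using base by (intro inv_max_Suc) auto
  also have "inv_max k m = inv_last (Suc k) m m - q * (\<Sum>t = 1..<m. inv_max k t)"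
    using inv_last_diag[of m k] base by simp
  finally show ?case unfolding 1 by (simp add: algebra_simps)
next
  case (step f)
  obtain k' where k: "k = Suc k'" using step.prems by (cases k) auto
  obtain g where f: "f = Suc g" using step.hyps step.prems by (cases f) auto
  have a: "inv_last (Suc (Suc k)) m (Suc (Suc f)) = inv_last (Suc (Suc k)) m (Suc f) + q * inv_last (Suc k) m (Suc f)"
    using step.hyps step.prems by (intro inv_last_Suc_Suc) auto
  have b: "inv_last (Suc k) m (Suc f) = inv_last (Suc k) m f + q * inv_last k m f"
    using step.hyps step.prems by (intro inv_last_Suc_Suc) auto
  \<comment> \<open>The sum on the right obeys the same recursion in the bound. The difference
    \<open>f - 1\<close> is the true predecessor \<open>g\<close>, because
    \<open>f \<ge> m \<ge> 1\<close>.\<close>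
  have c: "(\<Sum>h = 1..<m. inv_last (Suc k) h (Suc f) + (1 - q) * inv_last k h f) =
     (\<Sum>h = 1..<m. inv_last (Suc k) h f + (1 - q) * inv_last k h (f - 1)) +
     q * (\<Sum>h = 1..<m. inv_last k h f + (1 - q) * inv_last k' h (f - 1))"
    unfolding sum_distrib_left sum.distrib[symmetric]
  proof (intro sum.cong refl)
    fix h assume h: "h \<in> {1..<m}"
    have "inv_last (Suc k) h (Suc f) = inv_last (Suc k) h f + q * inv_last k h f"
      using step.hyps step.prems h by (intro inv_last_Suc_Suc) auto
    moreover have "inv_last (Suc k') h (Suc g) = inv_last (Suc k') h g + q * inv_last k' h g"
      using step.hyps step.prems h f k by (intro inv_last_Suc_Suc) auto
    ultimately show "inv_last (Suc k) h (Suc f) + (1 - q) * inv_last k h f =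
      inv_last (Suc k) h f + (1 - q) * inv_last k h (f - 1) +
      q * (inv_last k h f + (1 - q) * inv_last k' h (f - 1))"
      using f k by (simp add: algebra_simps)
  qed
  have IH1: "inv_last (Suc (Suc k)) m (Suc f) = (1 + q) * inv_last (Suc k) m f +
    q * (\<Sum>h = 1..<m. inv_last (Suc k) h f + (1 - q) * inv_last k h (f - 1))"
    using step.prems by (intro step.IH) auto
  have IH2: "inv_last (Suc k) m (Suc f) = (1 + q) * inv_last k m f +
    q * (\<Sum>h = 1..<m. inv_last k h f + (1 - q) * inv_last k' h (f - 1))"
    unfolding k using step.prems k by (intro step.IH) auto
  show ?case unfolding diff_Suc_1 c unfolding a IH1 using IH2 b by (simp add: algebra_simps)
qed

text \<open>The value \<open>n\<close> fits only into the last position, which holds the smaller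
  \<open>m\<close>.\<close>

lemma inv_last_max:
  assumes "1 \<le> m" "m < n"
  shows "inv_last n m n = inv_last n m (n - 1)"
proof -
  obtain k where n: "n = Suc k" using assms by (cases n) auto
  have "x \<le> k" if "e \<in> avoiding_inversion_sequences n" "last e = m" "x \<in> set e" for e x
  proof -
    from that(1) n have "e \<in> avoiding_inversion_sequences (Suc k)" by simp
    then obtain d where "e = d @ [last e]" "d \<in> avoiding_inversion_sequences k"
      by (rule avoiding_inversion_sequences_Suc_cases)
    then have "e = d @ [m]" "d \<in> avoiding_inversion_sequences k" using that(2) by auto
    then show ?thesis using that assms n avoiding_inversion_sequences_bounds(2)[of d k x] by auto
  qed
  then show ?thesis unfolding inv_last_def n by (intro sum.cong) fastforce+
qed

lemma sum_inv_last_max: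
  assumes "m \<le> n" "1 \<le> n"
  shows "(\<Sum>f = 1..<m. inv_last n f n) = (\<Sum>f = 1..<m. inv_last n f (n - 1))"
  using assms by (intro sum.cong inv_last_max) auto

lemma inv_last_one: "inv_last 1 1 1 = 1"
proof -
  have mem: "[Suc 0] \<in> avoiding_inversion_sequences (Suc 0)"
    by (simp add: avoiding_inversion_sequences_def inversion_sequences_def)
  have only: "e = [Suc 0]" if "e \<in> avoiding_inversion_sequences (Suc 0)" for e
    using that by (cases e) (auto simp: avoiding_inversion_sequences_def inversion_sequences_def)
  have "{e. e \<in> avoiding_inversion_sequences 1 \<and> last e = 1 \<and> (\<forall>x\<in>set e. x \<le> 1)} = {[1]}"
    by (auto simp: mem dest: only)
  then show ?thesis unfolding inv_last_def by (simp add: dist_values_def)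
qed

text \<open>The value \<open>n\<close> can only be the last entry. Here this is read off from the
  two countings: the terms with last entry or maximum below \<open>n\<close> cancel.\<close>

lemma inv_max_top:
  assumes "1 \<le> n"
  shows "inv_max n n = inv_last n n n"
proof -
  obtain k where n: "n = Suc k" using assms by (cases n) auto
  have "(\<Sum>f = 1..<n. inv_last n f n) = (\<Sum>t = 1..<n. inv_max n t)"
    unfolding sum_inv_last_max[OF order_refl assms]
    using sum_inv_last[of n k] n by (simp add: atLeastLessThanSuc_atLeastAtMost)
  then show ?thesis using sum_inv_last[of n n] n by (simp add: atLeastLessThanSuc_atLeastAtMost)
qed

section \<open>The common recurrence and its uniqueness\<close>

definition catalytic :: "(nat \<Rightarrow> nat \<Rightarrow> 'a) \<Rightarrow> bool" where
  "catalytic A \<longleftrightarrow> A 1 1 = 1 \<and>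
     (\<forall>n\<ge>1. A (Suc n) (Suc n) = q * (\<Sum>f = 1..n. A n f)) \<and>
     (\<forall>n\<ge>1. A (Suc n) n = A n n + q * (\<Sum>f = 1..<n. A n f)) \<and>
     (\<forall>n m. 1 \<le> m \<longrightarrow> m < n \<longrightarrow>
        A (Suc n) m = (1 + q) * A n m + q * (\<Sum>f = 1..<m. A n f + (1 - q) * A (n - 1) f))"

lemma catalyticD:
  assumes "catalytic A"
  shows "A 1 1 = 1"
    and "1 \<le> n \<Longrightarrow> A (Suc n) (Suc n) = q * (\<Sum>f = 1..n. A n f)"
    and "1 \<le> n \<Longrightarrow> A (Suc n) n = A n n + q * (\<Sum>f = 1..<n. A n f)"
    and "1 \<le> m \<Longrightarrow> m < n \<Longrightarrow>
      A (Suc n) m = (1 + q) * A n m + q * (\<Sum>f = 1..<m. A n f + (1 - q) * A (n - 1) f)"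
  using assms unfolding catalytic_def by blast+

text \<open>The right-hand sides refer only to shorter lengths and to entries not exceeding the
  length. In the last equation \<open>f < m < n\<close> ensures this also for the terms of length
  \<open>n - 1\<close>.\<close>

lemma catalytic_unique:
  assumes "catalytic A" "catalytic B" "1 \<le> m" "m \<le> n"
  shows "A n m = B n m"
  using assms(3,4)
proof (induction n arbitrary: m rule: less_induct)
  case (less n)
  show ?case
  proof (cases "n = 1")
    case True
    moreover have "m = 1" using True less.prems by simp
    ultimately show ?thesis using assms(1,2)[THEN catalyticD(1)] by (simp only:)
  next
    case False
    then obtain k where n: "n = Suc k" "1 \<le> k" using less.prems by (cases n) auto
    have eq: "A k f = B k f" if "1 \<le> f" "f \<le> k" for f using less.IH[of k f] that n by simp
    consider "m = Suc k" | "m = k" | "m < k" using less.prems n by linarith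
    then show ?thesis
    proof cases
      case 1
      moreover have "(\<Sum>f = 1..k. A k f) = (\<Sum>f = 1..k. B k f)" using eq by (intro sum.cong) auto
      ultimately show ?thesis
        using assms(1,2)[THEN catalyticD(2), OF n(2)] n(1) by (simp only:)
    next
      case 2
      have "(\<Sum>f = 1..<k. A k f) = (\<Sum>f = 1..<k. B k f)" using eq by (intro sum.cong) auto
      moreover have "A k k = B k k" using eq n(2) by simp
      ultimately show ?thesis
        using 2 assms(1,2)[THEN catalyticD(3), OF n(2)] n(1) by (simp only:)
    next
      case 3
      have "A (k - 1) f = B (k - 1) f" if "1 \<le> f" "f < m" for f
        using less.IH[of "k - 1" f] that n 3 by simp
      then have "(\<Sum>f = 1..<m. A k f + (1 - q) * A (k - 1) f) = (\<Sum>f = 1..<m. B k f + (1 - q) * B (k - 1) f)"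
        using eq 3 by (intro sum.cong) auto
      moreover have "A k m = B k m" using eq 3 less.prems by simp
      ultimately show ?thesis
        using assms(1,2)[THEN catalyticD(4), OF less.prems(1) 3] n(1) by (simp only:)
    qed
  qed
qed

text \<open>Bounding the entries by the length is no restriction. The general equation is
  \<open>inv_last_rec\<close> with bounds one below the length, which by \<open>inv_last_max\<close>
  give the same sums.\<close>

lemma catalytic_inv_last: "catalytic (\<lambda>n m. inv_last n m n)"
  unfolding catalytic_def
proof (intro conjI allI impI)
  show "inv_last 1 1 1 = 1" by (rule inv_last_one)
next
  fix n :: nat assume n: "1 \<le> n"
  have "{e. e \<in> avoiding_inversion_sequences n \<and> Suc n \<in> set e \<and> (\<forall>x\<in>set e. x \<le> Suc n)} = {}"
    using avoiding_inversion_sequences_bounds(2)[of _ n "Suc n"] by auto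
  then have "inv_max n (Suc n) = 0" by (simp only: inv_max_def sum.empty)
  then show "inv_last (Suc n) (Suc n) (Suc n) = q * (\<Sum>f = 1..n. inv_last n f n)"
    using inv_last_diag[of "Suc n" n] n sum_inv_last[of n n]
    by (simp add: atLeastLessThanSuc_atLeastAtMost)
next
  fix n :: nat assume n: "1 \<le> n"
  have "(\<Sum>f = 1..<n. inv_last n f n) = (\<Sum>t = 1..<n. inv_max n t)"
    unfolding sum_inv_last_max[OF order_refl n]
    using sum_inv_last[of n "n - 1"] n by (cases n) (simp_all add: atLeastLessThanSuc_atLeastAtMost)
  moreover have "inv_last (Suc n) n (Suc n) = inv_last (Suc n) n n"
    using inv_last_max[of n "Suc n"] n by simp
  ultimately show "inv_last (Suc n) n (Suc n) = inv_last n n n + q * (\<Sum>f = 1..<n. inv_last n f n)"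
    using inv_last_diag[of n n] inv_max_top[of n] n by simp
next
  fix n m :: nat assume m: "1 \<le> m" "m < n"
  obtain k where n: "n = Suc k" using m by (cases n) auto
  have "inv_last (Suc n) m (Suc n) = inv_last (Suc (Suc k)) m (Suc k)"
    using inv_last_max[of m "Suc n"] m n by simp
  also have "\<dots> = (1 + q) * inv_last n m k + q * (\<Sum>h = 1..<m. inv_last n h k + (1 - q) * inv_last k h (k - 1))"
    unfolding n using m n by (intro inv_last_rec) auto
  also have "inv_last n m k = inv_last n m n" using inv_last_max[of m n] m n by simp
  also have "(\<Sum>h = 1..<m. inv_last n h k + (1 - q) * inv_last k h (k - 1)) =
    (\<Sum>h = 1..<m. inv_last n h n + (1 - q) * inv_last (n - 1) h (n - 1))"
  proof (intro sum.cong refl)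
    fix h assume "h \<in> {1..<m}"
    then have "inv_last n h n = inv_last n h k" "inv_last k h k = inv_last k h (k - 1)"
      using inv_last_max[of h n] inv_last_max[of h k] m n by auto
    then show "inv_last n h k + (1 - q) * inv_last k h (k - 1) =
        inv_last n h n + (1 - q) * inv_last (n - 1) h (n - 1)"
      using n by (simp only: diff_Suc_1)
  qed
  finally show "inv_last (Suc n) m (Suc n) = (1 + q) * inv_last n m n +
      q * (\<Sum>f = 1..<m. inv_last n f n + (1 - q) * inv_last (n - 1) f (n - 1))" .
qed

end

subsection \<open>Relabelling and descents\<close>

text \<open>The increasing enumeration of the naturals other than \<open>m\<close>; it frees the
  value \<open>m\<close> for a new entry.\<close>

definition shift :: "nat \<Rightarrow> nat \<Rightarrow> nat" where
  "shift m y = (if y < m then y else Suc y)"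

lemma strict_mono_shift: "strict_mono (shift m)"
  by (auto simp: strict_mono_def shift_def)

lemma inj_shift: "inj (shift m)"
  using strict_mono_shift by (rule strict_mono_imp_inj_on)

lemma shift_less_iff [simp]: "shift m x < shift m y \<longleftrightarrow> x < y"
  using strict_mono_shift by (rule strict_mono_less)

lemma less_shift_iff [simp]: "m < shift m y \<longleftrightarrow> m \<le> y"
  by (auto simp: shift_def)

lemma shift_less_self_iff [simp]: "shift m y < m \<longleftrightarrow> y < m"
  by (auto simp: shift_def)

lemma le_shift_iff: "m \<le> f \<Longrightarrow> m \<le> shift f y \<longleftrightarrow> m \<le> y"
  by (auto simp: shift_def)

lemma shift_image: "m \<le> f \<Longrightarrow> f \<le> Suc n \<Longrightarrow> insert f (shift f ` {m..n}) = {m..Suc n}"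
proof (intro equalityI subsetI)
  fix x assume f: "m \<le> f" "f \<le> Suc n" and x: "x \<in> {m..Suc n}"
  consider "x = f" | "x < f" | "x > f" by linarith
  then show "x \<in> insert f (shift f ` {m..n})"
  proof cases
    case 2
    then have "x = shift f x" by (simp add: shift_def)
    then show ?thesis using x f 2 by auto
  next
    case 3
    then have "x = shift f (x - 1)" by (simp add: shift_def)
    then show ?thesis using x f 3 by (intro insertI2 image_eqI[of _ _ "x - 1"]) auto
  qed simp
qed (auto simp: shift_def)

lemma shift_not_in_image: "f \<notin> shift f ` S"
  by (auto simp: shift_def)

lemma subseq_map_conv: "subseq xs (map f ys) \<longleftrightarrow> (\<exists>zs. subseq zs ys \<and> xs = map f zs)"
  by (auto simp: subseq_conv_nths nths_map)

lemma subseq_map_three: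
  "subseq [a, b, c] (map f w) \<longleftrightarrow>
    (\<exists>a' b' c'. subseq [a', b', c'] w \<and> a = f a' \<and> b = f b' \<and> c = f c')"
  unfolding subseq_map_conv Cons_eq_map_conv by blast

lemma subseq_map_four:
  "subseq [z, a, b, c] (map f w) \<longleftrightarrow>
    (\<exists>z' a' b' c'. subseq [z', a', b', c'] w \<and> z = f z' \<and> a = f a' \<and> b = f b' \<and> c = f c')"
  unfolding subseq_map_conv Cons_eq_map_conv by blast

lemma subseq_set: "subseq xs ys \<Longrightarrow> set xs \<subseteq> set ys"
  by (auto simp: subseq_conv_nths dest: in_set_nthsD)

lemma subseq_filter_conv: "subseq xs (filter P ys) \<longleftrightarrow> subseq xs ys \<and> (\<forall>x\<in>set xs. P x)"
proof
  assume L: "subseq xs (filter P ys)"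
  then have "subseq xs ys" using subseq_filter_left subseq_order.order_trans by blast
  moreover have "set xs \<subseteq> set (filter P ys)" using L by (rule subseq_set)
  ultimately show "subseq xs ys \<and> (\<forall>x\<in>set xs. P x)" by auto
next
  assume R: "subseq xs ys \<and> (\<forall>x\<in>set xs. P x)"
  then have "subseq (filter P xs) (filter P ys)" by (intro subseq_filter) simp
  then show "subseq xs (filter P ys)" using R by simp
qed

lemma filter_eq_shift_iff:
  assumes "m \<le> f"
  shows "filter ((\<le>) m) (f # map (shift f) p) = f # map (shift f) (filter ((\<le>) m) p)"
  using assms by (simp add: filter_map o_def le_shift_iff)

section \<open>Descents of a word with a new first letter\<close>

lemma desc_Cons:
  assumes "xs \<noteq> []"
  shows "desc (x # xs) = (if hd xs < x then 1 else 0) + desc xs"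
proof -
  let ?S = "{i. Suc i < length xs \<and> xs ! i > xs ! Suc i}"
  have "{i. Suc i < length (x # xs) \<and> (x # xs) ! i > (x # xs) ! Suc i}
      = (if hd xs < x then {0} else {}) \<union> Suc ` ?S"
  proof (rule set_eqI)
    fix i
    show "i \<in> {i. Suc i < length (x # xs) \<and> (x # xs) ! i > (x # xs) ! Suc i} \<longleftrightarrow>
        i \<in> (if hd xs < x then {0} else {}) \<union> Suc ` ?S"
      using assms by (cases i) (auto simp: hd_conv_nth)
  qed
  moreover have "finite ?S" by (rule finite_subset[of _ "{..<length xs}"]) auto
  then have "card ((if P then {0} else {}) \<union> Suc ` ?S) = (if P then 1 else 0) + card ?S" for P
    by (simp add: card_image)
  ultimately show ?thesis by (simp add: desc_def)
qed

lemma desc_Nil [simp]: "desc [] = 0" and desc_single [simp]: "desc [x] = 0"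
  by (simp_all add: desc_def)

lemma desc_map_strict_mono: "strict_mono f \<Longrightarrow> desc (map f xs) = desc xs"
  by (induction xs rule: induct_list012) (simp_all add: desc_Cons strict_mono_less)

lemma desc_Cons_map_shift:
  "p \<noteq> [] \<Longrightarrow> desc (f # map (shift f) p) = (if hd p < f then 1 else 0) + desc p"
  by (simp add: desc_Cons hd_map desc_map_strict_mono strict_mono_shift)

lemma desc_less_length: "xs \<noteq> [] \<Longrightarrow> desc xs < length xs"
  by (induction xs rule: induct_list012) (auto simp: desc_Cons)

subsection \<open>Prepending a first entry\<close>

text \<open>\<open>R\<close> selects the order types of the triples that may not follow a smaller entry.\<close>

locale triple_avoidance =
  fixes R :: "nat \<Rightarrow> nat \<Rightarrow> nat \<Rightarrow> bool" and q :: "'a::comm_ring_1"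
  assumes R_strict_mono: "strict_mono f \<Longrightarrow> R (f a) (f b) (f c) \<longleftrightarrow> R a b c"
begin

definition good :: "nat list \<Rightarrow> bool" where
  "good w \<longleftrightarrow> (\<forall>a b c. subseq [a, b, c] w \<longrightarrow> \<not> R a b c)"

text \<open>For \<open>R\<close> the union of two patterns of length three, this is avoidance of the
  two patterns of length four that prefix a smallest entry; \<open>z\<close> plays the role of that
  entry.\<close>

definition perms :: "nat \<Rightarrow> nat list set" where
  "perms n = {p \<in> permutations_of_set {1..n}.
     \<forall>z a b c. subseq [z, a, b, c] p \<longrightarrow> z < a \<longrightarrow> z < b \<longrightarrow> z < c \<longrightarrow> \<not> R a b c}"

lemma good_map: "strict_mono f \<Longrightarrow> good (map f w) \<longleftrightarrow> good w"
  unfolding good_def subseq_map_three using R_strict_mono by blast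

lemma good_subseq: "good w \<Longrightarrow> subseq v w \<Longrightarrow> good v"
  unfolding good_def using subseq_order.order_trans by blast

lemma good_filter_mono:
  assumes "good (filter P w)" "\<And>x. x \<in> set w \<Longrightarrow> Q x \<Longrightarrow> P x"
  shows "good (filter Q w)"
  using assms unfolding good_def subseq_filter_conv
  by (metis list.set_intros(1) list.set_intros(2) subseq_set subsetD)

lemma good_short: "length w < 3 \<Longrightarrow> good w"
  unfolding good_def by (auto dest: list_emb_length)

lemma finite_perms [simp]: "finite (perms n)"
  by (simp add: perms_def)

lemma permsD:
  assumes "p \<in> perms n"
  shows "set p = {1..n}" "distinct p" "length p = n"
  using assms by (auto simp: perms_def permutations_of_set_def length_finite_permutations_of_set)

lemma perms_ne: "p \<in> perms n \<Longrightarrow> 1 \<le> n \<Longrightarrow> p \<noteq> []"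
  using permsD(3) by fastforce

lemma hd_perms: "p \<in> perms n \<Longrightarrow> 1 \<le> n \<Longrightarrow> hd p \<in> {1..n}"
  using permsD(1) perms_ne by (metis hd_in_set)

text \<open>The only new quadruples start at \<open>x\<close>, and their other entries are taken
  from those above \<open>x\<close>.\<close>

lemma avoid_Cons_iff:
  "(\<forall>z a b c. subseq [z, a, b, c] (x # xs) \<longrightarrow> z < a \<longrightarrow> z < b \<longrightarrow> z < c \<longrightarrow> \<not> R a b c) \<longleftrightarrow>
   (\<forall>z a b c. subseq [z, a, b, c] xs \<longrightarrow> z < a \<longrightarrow> z < b \<longrightarrow> z < c \<longrightarrow> \<not> R a b c) \<and>
   good (filter ((<) x) xs)"
  (is "?L \<longleftrightarrow> ?R1 \<and> ?R2")
proof
  assume L: ?L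
  have ?R1 using L list_emb_Cons by blast
  moreover have ?R2
    unfolding good_def subseq_filter_conv
  proof (intro allI impI)
    fix a b c assume "subseq [a, b, c] xs \<and> (\<forall>y\<in>set [a, b, c]. x < y)"
    then show "\<not> R a b c" using L[rule_format, of x a b c] by simp
  qed
  ultimately show "?R1 \<and> ?R2" by blast
next
  assume R: "?R1 \<and> ?R2"
  show ?L
  proof (intro allI impI)
    fix z a b c assume s: "subseq [z, a, b, c] (x # xs)" and z: "z < a" "z < b" "z < c"
    show "\<not> R a b c"
    proof (cases "z = x")
      case True
      then have "subseq [a, b, c] xs" using s by (simp add: subseq_Cons2_iff)
      then show ?thesis using R True z by (auto simp: good_def subseq_filter_conv)
    next
      case False
      then have "subseq [z, a, b, c] xs" using s by (simp add: subseq_Cons2_iff)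
      then show ?thesis using R z by blast
    qed
  qed
qed

lemma avoid_map:
  assumes "strict_mono f"
  shows "(\<forall>z a b c. subseq [z, a, b, c] (map f xs) \<longrightarrow> z < a \<longrightarrow> z < b \<longrightarrow> z < c \<longrightarrow> \<not> R a b c) \<longleftrightarrow>
   (\<forall>z a b c. subseq [z, a, b, c] xs \<longrightarrow> z < a \<longrightarrow> z < b \<longrightarrow> z < c \<longrightarrow> \<not> R a b c)"
  unfolding subseq_map_four using strict_mono_less[OF assms] R_strict_mono[OF assms] by blast

text \<open>After relabelling, the entries above the new first entry \<open>m\<close> are the images
  of the entries \<open>\<ge> m\<close> of \<open>p\<close>, so only these have to be good.\<close>

lemma Cons_map_shift_mem_perms:
  assumes "1 \<le> m" "m \<le> Suc n"
  shows "m # map (shift m) p \<in> perms (Suc n) \<longleftrightarrow> p \<in> perms n \<and> good (filter ((\<le>) m) p)"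
proof -
  have good: "good (filter ((<) m) (map (shift m) p)) \<longleftrightarrow> good (filter ((\<le>) m) p)"
    by (simp add: filter_map o_def good_map[OF strict_mono_shift])
  have "m # map (shift m) p \<in> permutations_of_set {1..Suc n} \<longleftrightarrow> p \<in> permutations_of_set {1..n}"
  proof -
    have "insert m (shift m ` set p) = {1..Suc n} \<longleftrightarrow> set p = {1..n}"
    proof
      assume "insert m (shift m ` set p) = {1..Suc n}"
      then have "insert m (shift m ` set p) = insert m (shift m ` {1..n})"
        using shift_image[OF assms] by simp
      then have "shift m ` set p = shift m ` {1..n}"
        using shift_not_in_image by (metis insert_ident)
      then show "set p = {1..n}" using inj_image_eq_iff[OF inj_shift] by blast
    qed (use shift_image[OF assms] in simp)
    then show ?thesis
      using shift_not_in_image[of m "set p"]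
      by (auto simp: permutations_of_set_def distinct_map intro: inj_on_subset[OF inj_shift])
  qed
  then show ?thesis
    unfolding perms_def mem_Collect_eq avoid_Cons_iff good avoid_map[OF strict_mono_shift] by blast
qed

lemma perms_SucE:
  assumes "p \<in> perms (Suc n)"
  obtains m r where "1 \<le> m" "m \<le> Suc n" "p = m # map (shift m) r" "r \<in> perms n"
    "good (filter ((\<le>) m) r)"
proof -
  obtain m t where p: "p = m # t" using perms_ne[OF assms] by (cases p) auto
  have m: "1 \<le> m" "m \<le> Suc n" using hd_perms[OF assms] p by auto
  have "set t = {1..Suc n} - {m}" using permsD[OF assms] p by auto
  also have "\<dots> = shift m ` {1..n}" using shift_image[OF m] shift_not_in_image[of m "{1..n}"] by blast
  finally have "set t \<subseteq> range (shift m)" by blast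
  then obtain r where "t = map (shift m) r" using ex_map_conv[of t "shift m"] by blast
  then show thesis using that[of m r] p m assms Cons_map_shift_mem_perms[OF m, of r] by blast
qed

section \<open>Sums weighted by descents and the effect of prepending\<close>

definition psum :: "(nat list \<Rightarrow> bool) \<Rightarrow> nat \<Rightarrow> 'a" where
  "psum P n = (\<Sum>p\<in>perms n. if P p then q ^ desc p else 0)"

lemma psum_cong:
  "(\<And>p. p \<in> perms n \<Longrightarrow> P p \<longleftrightarrow> Q p) \<Longrightarrow> psum P n = psum Q n"
  unfolding psum_def by (intro sum.cong) auto

lemma psum_split: "psum P n = psum (\<lambda>p. P p \<and> Q p) n + psum (\<lambda>p. P p \<and> \<not> Q p) n"
  unfolding psum_def sum.distrib[symmetric] by (intro sum.cong) auto

lemma psum_partition: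
  assumes "finite I" "\<And>p. p \<in> perms n \<Longrightarrow> P p \<Longrightarrow> f p \<in> I"
  shows "psum P n = (\<Sum>i\<in>I. psum (\<lambda>p. P p \<and> f p = i) n)"
proof -
  have "psum P n = (\<Sum>p\<in>perms n. \<Sum>i\<in>I. if P p \<and> f p = i then q ^ desc p else 0)"
    unfolding psum_def
  proof (intro sum.cong refl)
    fix p assume p: "p \<in> perms n"
    show "(if P p then q ^ desc p else 0) = (\<Sum>i\<in>I. if P p \<and> f p = i then q ^ desc p else 0)"
      using assms p by (cases "P p") (simp_all add: sum.delta')
  qed
  then show ?thesis unfolding psum_def by (subst sum.swap)
qed

text \<open>The entries \<open>\<ge> m\<close> all follow the first entry and exceed it, so
  avoidance in \<open>p\<close> already makes them good.\<close>

lemma good_filter_hd_less: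
  assumes "p \<in> perms n" "1 \<le> n" "hd p < m"
  shows "good (filter ((\<le>) m) p)"
proof -
  obtain x xs where p: "p = x # xs" using perms_ne[OF assms(1,2)] by (cases p) auto
  have "good (filter ((<) x) xs)"
    using assms(1) unfolding p perms_def mem_Collect_eq avoid_Cons_iff by blast
  then have "good (filter ((\<le>) m) xs)" by (rule good_filter_mono) (use assms p in auto)
  then show ?thesis using assms p by simp
qed

text \<open>Prepending \<open>m\<close> adds a descent exactly if \<open>hd p < m\<close>. In that
  case the entries \<open>\<ge> m\<close> are good by \<open>good_filter_hd_less\<close>, so the
  condition is visible only in the first sum.\<close>

lemma psum_prepend:
  assumes "1 \<le> n" "1 \<le> m" "m \<le> Suc n"
  shows "psum (\<lambda>p. hd p = m \<and> P p) (Suc n) =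
    psum (\<lambda>p. m \<le> hd p \<and> good (filter ((\<le>) m) p) \<and> P (m # map (shift m) p)) n +
    q * psum (\<lambda>p. hd p < m \<and> P (m # map (shift m) p)) n"
proof -
  let ?f = "\<lambda>p. m # map (shift m) p"
  let ?S = "{p \<in> perms n. good (filter ((\<le>) m) p)}"
  have "psum (\<lambda>p. hd p = m \<and> P p) (Suc n) =
      (\<Sum>p\<in>{p \<in> perms (Suc n). hd p = m}. if P p then q ^ desc p else 0)"
    unfolding psum_def by (subst sum.inter_filter) (auto intro: sum.cong)
  also have "{p \<in> perms (Suc n). hd p = m} = ?f ` ?S"
  proof (intro equalityI subsetI)
    fix p assume "p \<in> {p \<in> perms (Suc n). hd p = m}"
    then show "p \<in> ?f ` ?S" by (auto elim: perms_SucE)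
  qed (use Cons_map_shift_mem_perms[OF assms(2,3)] in auto)
  also have "(\<Sum>p\<in>?f ` ?S. if P p then q ^ desc p else 0) =
      (\<Sum>p\<in>?S. if P (?f p) then q ^ desc (?f p) else 0)"
    using inj_shift by (subst sum.reindex) (auto intro!: inj_onI simp: inj_map_eq_map)
  also have "\<dots> = (\<Sum>p\<in>perms n. if good (filter ((\<le>) m) p) then if P (?f p) then q ^ desc (?f p) else 0 else 0)"
    by (subst sum.inter_filter) auto
  also have "\<dots> = (\<Sum>p\<in>perms n. (if m \<le> hd p \<and> good (filter ((\<le>) m) p) \<and> P (?f p) then q ^ desc p else 0) +
      q * (if hd p < m \<and> P (?f p) then q ^ desc p else 0))"
  proof (intro sum.cong refl)
    fix p assume p: "p \<in> perms n"
    then have "desc (?f p) = (if hd p < m then 1 else 0) + desc p"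
      using perms_ne assms by (intro desc_Cons_map_shift) auto
    then show "(if good (filter ((\<le>) m) p) then if P (?f p) then q ^ desc (?f p) else 0 else 0) =
        (if m \<le> hd p \<and> good (filter ((\<le>) m) p) \<and> P (?f p) then q ^ desc p else 0) +
        q * (if hd p < m \<and> P (?f p) then q ^ desc p else 0)"
      using good_filter_hd_less[OF p assms(1), of m] by auto
  qed
  also have "\<dots> = psum (\<lambda>p. m \<le> hd p \<and> good (filter ((\<le>) m) p) \<and> P (?f p)) n +
      q * psum (\<lambda>p. hd p < m \<and> P (?f p)) n"
    unfolding psum_def by (simp add: sum.distrib sum_distrib_left)
  finally show ?thesis .
qed

section \<open>Sums by first entry and their recurrence\<close>

definition first_sum :: "nat \<Rightarrow> nat \<Rightarrow> 'a" where
  "first_sum n m = psum (\<lambda>p. hd p = m) n"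

definition high_sum :: "nat \<Rightarrow> nat \<Rightarrow> 'a" where
  "high_sum n m = psum (\<lambda>p. m \<le> hd p \<and> good (filter ((\<le>) m) p)) n"

lemma psum_hd_less:
  assumes "1 \<le> n"
  shows "psum (\<lambda>p. hd p < m) n = (\<Sum>f = 1..<m. first_sum n f)"
proof -
  have "psum (\<lambda>p. hd p < m) n = (\<Sum>f = 1..<m. psum (\<lambda>p. hd p < m \<and> hd p = f) n)"
    using hd_perms assms by (intro psum_partition) auto
  also have "\<dots> = (\<Sum>f = 1..<m. first_sum n f)"
    unfolding first_sum_def by (intro sum.cong psum_cong) auto
  finally show ?thesis .
qed

lemma first_sum_Suc:
  assumes "1 \<le> n" "1 \<le> m" "m \<le> Suc n"
  shows "first_sum (Suc n) m = high_sum n m + q * (\<Sum>f = 1..<m. first_sum n f)"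
  using psum_prepend[OF assms, of "\<lambda>_. True"] psum_hd_less[OF assms(1), of m]
  by (simp add: first_sum_def[of "Suc n"] high_sum_def)

text \<open>Only one entry is at least \<open>n\<close>, and a word of one letter is good.\<close>

lemma high_sum_top: "1 \<le> n \<Longrightarrow> high_sum n n = first_sum n n"
  unfolding high_sum_def first_sum_def
proof (rule psum_cong)
  fix p assume n: "1 \<le> n" and p: "p \<in> perms n"
  have "set (filter ((\<le>) n) p) = {n}" using permsD(1)[OF p] n by auto
  moreover have "distinct (filter ((\<le>) n) p)" using permsD(2)[OF p] by simp
  ultimately have "length (filter ((\<le>) n) p) = 1" by (metis distinct_card is_singletonI is_singleton_altdef)
  then have "good (filter ((\<le>) n) p)" by (intro good_short) simp
  then show "(n \<le> hd p \<and> good (filter ((\<le>) n) p)) = (hd p = n)" using hd_perms[OF p n] by auto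
qed

lemma high_sum_Suc_eq_0: "1 \<le> n \<Longrightarrow> high_sum n (Suc n) = 0"
  unfolding high_sum_def psum_def using hd_perms by (intro sum.neutral) fastforce

lemma psum_good:
  assumes "1 \<le> n"
  shows "psum (\<lambda>p. good (filter ((\<le>) m) p)) n = high_sum n m + (\<Sum>f = 1..<m. first_sum n f)"
proof -
  have "psum (\<lambda>p. good (filter ((\<le>) m) p)) n =
     psum (\<lambda>p. good (filter ((\<le>) m) p) \<and> m \<le> hd p) n + psum (\<lambda>p. good (filter ((\<le>) m) p) \<and> \<not> m \<le> hd p) n"
    by (rule psum_split)
  also have "psum (\<lambda>p. good (filter ((\<le>) m) p) \<and> m \<le> hd p) n = high_sum n m"
    unfolding high_sum_def by (intro psum_cong) auto
  also have "psum (\<lambda>p. good (filter ((\<le>) m) p) \<and> \<not> m \<le> hd p) n = psum (\<lambda>p. hd p < m) n"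
    using good_filter_hd_less assms by (intro psum_cong) auto
  finally show ?thesis using psum_hd_less[OF assms, of m] by simp
qed

lemma first_sum_one: "first_sum 1 1 = 1"
proof -
  have "\<not> subseq [z, a, b, c] [Suc 0]" for z a b c using list_emb_length by fastforce
  then have "perms 1 = {[1]}" by (auto simp: perms_def)
  then show ?thesis by (simp add: first_sum_def psum_def)
qed

text \<open>The auxiliary \<open>high_sum\<close> is eliminated: at length \<open>n\<close> by the
  hypothesis, which is the doubling rule, and at length \<open>n - 1\<close> by solving
  \<open>first_sum_Suc\<close> for it.\<close>

lemma catalytic_first_sum:
  assumes high_sum_Suc: "\<And>n m. 1 \<le> m \<Longrightarrow> m \<le> n \<Longrightarrow> high_sum (Suc n) m =
    first_sum (Suc n) m + q * psum (\<lambda>p. good (filter ((\<le>) m) p)) n"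
  shows "catalytic q first_sum"
  unfolding catalytic_def
proof (intro conjI allI impI)
  show "first_sum 1 1 = 1" by (rule first_sum_one)
  fix n :: nat assume n: "1 \<le> n"
  show "first_sum (Suc n) (Suc n) = q * (\<Sum>f = 1..n. first_sum n f)"
    using first_sum_Suc[of n "Suc n"] high_sum_Suc_eq_0[OF n] n
    by (simp add: atLeastLessThanSuc_atLeastAtMost)
  show "first_sum (Suc n) n = first_sum n n + q * (\<Sum>f = 1..<n. first_sum n f)"
    using first_sum_Suc[of n n] high_sum_top[OF n] n by simp
next
  fix n m :: nat assume m: "1 \<le> m" "m < n"
  obtain k where n: "n = Suc k" using m by (cases n) auto
  have "first_sum (Suc n) m = high_sum (Suc k) m + q * (\<Sum>f = 1..<m. first_sum n f)"
    using first_sum_Suc[of n m] m n by simp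
  also have "high_sum (Suc k) m = first_sum n m + q * (high_sum k m + (\<Sum>f = 1..<m. first_sum k f))"
    using high_sum_Suc[of m k] psum_good[of k m] m n by simp
  also have "high_sum k m = first_sum n m - q * (\<Sum>f = 1..<m. first_sum k f)"
    using first_sum_Suc[of k m] m n by simp
  finally show "first_sum (Suc n) m = (1 + q) * first_sum n m +
      q * (\<Sum>f = 1..<m. first_sum n f + (1 - q) * first_sum (n - 1) f)"
    using n by (simp add: algebra_simps sum.distrib sum_distrib_left sum_subtractf)
qed

lemma first_sum_Suc_psum:
  assumes "1 \<le> n" "1 \<le> m" "m \<le> n"
  shows "first_sum (Suc n) m = psum (\<lambda>p. m \<le> hd p \<and> good (filter ((\<le>) m) p)) n + q * psum (\<lambda>p. hd p < m) n"
  using psum_prepend[OF assms(1,2), of "\<lambda>_. True"] assms by (simp add: first_sum_def)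

text \<open>Here the doubling rule is literal. If \<open>hd p \<ge> m\<close>, it is also the head
  of the large word, so prepending \<open>l\<close> adds no descent and \<open>h\<close> adds one.
  If \<open>hd p < m\<close>, both values exceed it and each adds a descent.\<close>

lemma catalytic_first_sum_two_heads:
  assumes heads: "\<And>m n w. w \<noteq> [] \<Longrightarrow> distinct w \<Longrightarrow> set w = {m..n} \<Longrightarrow> good w \<Longrightarrow>
    \<exists>l h. m \<le> l \<and> l \<le> hd w \<and> hd w < h \<and> h \<le> Suc n \<and>
      (\<forall>f\<in>{m..Suc n}. good (f # map (shift f) w) \<longleftrightarrow> f = l \<or> f = h)"
  shows "catalytic q first_sum"
proof (rule catalytic_first_sum)
  fix n m :: nat assume m: "1 \<le> m" "m \<le> n"
  let ?w = "\<lambda>p. filter ((\<le>) m) p"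
  let ?G = "\<lambda>f p. good (f # map (shift f) (?w p))"
  \<comment> \<open>Goodness of the extended large word implies the condition of
    \<open>psum_prepend\<close>, because the entries \<open>\<ge> f\<close> are among those
    \<open>\<ge> m\<close>.\<close>
  have fil: "good (filter ((\<le>) f) p)" if "m \<le> f" "?G f p" for f p
  proof -
    have "good (map (shift f) (?w p))" using that(2) by (rule good_subseq) (simp add: list_emb_Cons)
    then have "good (?w p)" by (simp add: good_map strict_mono_shift)
    then show ?thesis by (rule good_filter_mono) (use that(1) in auto)
  qed
  have "high_sum (Suc n) m = (\<Sum>f\<in>{m..Suc n}. psum (\<lambda>p. (m \<le> hd p \<and> good (?w p)) \<and> hd p = f) (Suc n))"
    unfolding high_sum_def using hd_perms by (intro psum_partition) fastforce+
  also have "\<dots> = (\<Sum>f\<in>{m..Suc n}. psum (\<lambda>p. f \<le> hd p \<and> ?G f p) n + q * psum (\<lambda>p. hd p < f \<and> ?G f p) n)"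
  proof (intro sum.cong refl)
    fix f assume f: "f \<in> {m..Suc n}"
    have "psum (\<lambda>p. (m \<le> hd p \<and> good (?w p)) \<and> hd p = f) (Suc n) = psum (\<lambda>p. hd p = f \<and> good (?w p)) (Suc n)"
      using f by (intro psum_cong) auto
    also have "\<dots> = psum (\<lambda>p. f \<le> hd p \<and> good (filter ((\<le>) f) p) \<and> good (?w (f # map (shift f) p))) n +
        q * psum (\<lambda>p. hd p < f \<and> good (?w (f # map (shift f) p))) n"
      using f m by (intro psum_prepend) auto
    also have "\<dots> = psum (\<lambda>p. f \<le> hd p \<and> ?G f p) n + q * psum (\<lambda>p. hd p < f \<and> ?G f p) n"
      using f fil by (auto simp: filter_eq_shift_iff simp del: filter.simps intro!: arg_cong2[of _ _ _ _ "(+)"] psum_cong)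
    finally show "psum (\<lambda>p. (m \<le> hd p \<and> good (?w p)) \<and> hd p = f) (Suc n) = \<dots>" .
  qed
  also have "\<dots> = (\<Sum>p\<in>perms n. \<Sum>f\<in>{m..Suc n}.
      if ?G f p then (if f \<le> hd p then q ^ desc p else q * q ^ desc p) else 0)"
    unfolding psum_def sum_distrib_left sum.distrib[symmetric]
    by (subst sum.swap) (auto intro!: sum.cong)
  \<comment> \<open>The first two terms belong to the lower value \<open>l\<close> and add up to
    \<open>first_sum (Suc n) m\<close>; the third belongs to \<open>h\<close>.\<close>
  also have "\<dots> = (\<Sum>p\<in>perms n. (if m \<le> hd p \<and> good (?w p) then q ^ desc p else 0) +
      q * (if hd p < m then q ^ desc p else 0) + q * (if good (?w p) then q ^ desc p else 0))"
  proof (intro sum.cong refl)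
    fix p assume p: "p \<in> perms n"
    show "(\<Sum>f\<in>{m..Suc n}. if ?G f p then (if f \<le> hd p then q ^ desc p else q * q ^ desc p) else 0) =
      (if m \<le> hd p \<and> good (?w p) then q ^ desc p else 0) +
      q * (if hd p < m then q ^ desc p else 0) + q * (if good (?w p) then q ^ desc p else 0)"
    proof (cases "good (?w p)")
      case False
      then have "\<not> ?G f p" if "f \<in> {m..Suc n}" for f using fil[of f p] that
        by (meson good_map good_subseq strict_mono_shift subseq_Cons' subseq_order.order_refl)
      moreover have "\<not> hd p < m" using good_filter_hd_less[OF p, of m] m False by auto
      ultimately show ?thesis using False by (simp add: sum.neutral)
    next
      case True
      have "n \<in> set (?w p)" "set (?w p) = {m..n}" "distinct (?w p)" using permsD[OF p] m by auto
      then obtain l h where lh: "m \<le> l" "l \<le> hd (?w p)" "hd (?w p) < h" "h \<le> Suc n"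
        and G: "\<And>f. f \<in> {m..Suc n} \<Longrightarrow> ?G f p \<longleftrightarrow> f = l \<or> f = h"
        using heads[of "?w p" m n] True by (metis empty_iff empty_set)
      have "(\<Sum>f\<in>{m..Suc n}. if ?G f p then (if f \<le> hd p then q ^ desc p else q * q ^ desc p) else 0) =
          (\<Sum>f\<in>{l, h}. if f \<le> hd p then q ^ desc p else q * q ^ desc p)"
        using G lh by (intro sum.mono_neutral_cong_right) auto
      also have "\<dots> = (if l \<le> hd p then q ^ desc p else q * q ^ desc p) + (if h \<le> hd p then q ^ desc p else q * q ^ desc p)"
        using lh by simp
      also have "\<dots> = (if m \<le> hd p then q ^ desc p else q * q ^ desc p) + q * q ^ desc p"
      proof (cases "m \<le> hd p")
        case True
        then have "hd (?w p) = hd p" using perms_ne[OF p] m by (cases p) auto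
        then show ?thesis using lh True by auto
      qed (use lh in auto)
      finally show ?thesis using True by auto
    qed
  qed
  also have "\<dots> = first_sum (Suc n) m + q * psum (\<lambda>p. good (?w p)) n"
    using first_sum_Suc_psum[of n m] m unfolding psum_def by (simp add: sum.distrib sum_distrib_left)
  finally show "high_sum (Suc n) m = first_sum (Suc n) m + q * psum (\<lambda>p. good (?w p)) n" .
qed

end

subsection \<open>Fixing the word of large entries\<close>

context triple_avoidance
begin

definition words :: "nat \<Rightarrow> nat \<Rightarrow> nat list set" where
  "words m n = {w. distinct w \<and> set w = {m..n} \<and> good w}"

definition high :: "nat \<Rightarrow> nat \<Rightarrow> nat list \<Rightarrow> 'a" where
  "high m n w = psum (\<lambda>p. m \<le> hd p \<and> filter ((\<le>) m) p = w) n"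

definition low :: "nat \<Rightarrow> nat \<Rightarrow> nat list \<Rightarrow> 'a" where
  "low m n w = psum (\<lambda>p. hd p < m \<and> filter ((\<le>) m) p = w) n"

lemma finite_words [simp]: "finite (words m n)"
proof (rule finite_subset)
  show "words m n \<subseteq> permutations_of_set {m..n}" by (auto simp: words_def permutations_of_set_def)
qed simp

lemma words_ne: "w \<in> words m n \<Longrightarrow> m \<le> n \<Longrightarrow> w \<noteq> []"
  by (auto simp: words_def)

lemma length_words: "w \<in> words m (m + k) \<Longrightarrow> length w = Suc k"
  using distinct_card[of w] by (simp add: words_def)

lemma desc_words_le: "w \<in> words m (m + k) \<Longrightarrow> desc w \<le> k"
  using desc_less_length[of w] length_words[of w m k] by fastforce

lemma filter_mem_words: "p \<in> perms n \<Longrightarrow> 1 \<le> m \<Longrightarrow> good (filter ((\<le>) m) p) \<Longrightarrow> filter ((\<le>) m) p \<in> words m n"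
  using permsD[of p n] by (auto simp: words_def)

lemma words_SucE:
  assumes "w \<in> words m (Suc n)" "m \<le> Suc n"
  obtains f v where "m \<le> f" "f \<le> Suc n" "w = f # map (shift f) v" "v \<in> words m n"
proof -
  obtain f t where w: "w = f # t" using words_ne[OF assms] by (cases w) auto
  have "f \<in> set w" using w by simp
  then have f: "m \<le> f" "f \<le> Suc n" using assms(1) by (auto simp: words_def)
  have "set t = {m..Suc n} - {f}" using assms w by (auto simp: words_def)
  also have "\<dots> = shift f ` {m..n}" using shift_image[OF f] shift_not_in_image[of f "{m..n}"] by blast
  finally have t: "set t = shift f ` {m..n}" .
  then have "set t \<subseteq> range (shift f)" by blast
  then obtain v where v: "t = map (shift f) v" using ex_map_conv[of t "shift f"] by blast
  have "set v = {m..n}" using t v inj_image_eq_iff[OF inj_shift] by auto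
  moreover have "distinct v" using assms w v by (auto simp: words_def distinct_map)
  moreover have "subseq t w" using w by (simp add: list_emb_Cons)
  then have "good t" using assms(1) good_subseq[of w t] by (simp add: words_def)
  then have "good v" using v by (simp add: good_map strict_mono_shift)
  ultimately show thesis using that[of f v] f w v by (simp add: words_def)
qed

lemma bij_betw_map_Suc_words: "bij_betw (map Suc) (words m n) (words (Suc m) (Suc n))"
proof (rule bij_betwI')
  show "(map Suc x = map Suc y) = (x = y)" for x y by (simp add: inj_map_eq_map)
  have Suc: "strict_mono Suc" by (simp add: strict_mono_def)
  show "map Suc x \<in> words (Suc m) (Suc n)" if "x \<in> words m n" for x
    using that by (auto simp: words_def distinct_map good_map[OF Suc])
  show "\<exists>x\<in>words m n. y = map Suc x" if y: "y \<in> words (Suc m) (Suc n)" for y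
  proof -
    have "set y \<subseteq> range Suc" using y by (auto simp: words_def image_iff dest: Suc_le_D)
    then obtain x where x: "y = map Suc x" using ex_map_conv[of y Suc] by blast
    have "Suc ` set x = Suc ` {m..n}" using y x by (simp add: words_def)
    then have "set x = {m..n}" using inj_image_eq_iff[OF inj_Suc] by blast
    then have "x \<in> words m n" using y x by (auto simp: words_def distinct_map good_map[OF Suc])
    then show ?thesis using x by blast
  qed
qed

lemma desc_map_Suc: "desc (map Suc w) = desc w"
  by (rule desc_map_strict_mono) (simp add: strict_mono_def)

lemma hd_filter: "p \<noteq> [] \<Longrightarrow> m \<le> hd p \<Longrightarrow> hd (filter ((\<le>) m) p) = hd p"
  by (cases p) auto

text \<open>If \<open>hd p < m\<close>, prepending \<open>f\<close> always creates a descent.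
  Otherwise \<open>hd p = hd v\<close>, and a descent arises exactly for
  \<open>hd v < f\<close>.\<close>

lemma high_Cons:
  assumes m: "1 \<le> m" "m \<le> f" "f \<le> Suc n" "m \<le> n" and v: "v \<in> words m n"
  shows "high m (Suc n) (f # map (shift f) v) =
    (if hd v < f then q * (high m n v + low m n v) else high m n v + q * low m n v)"
proof -
  let ?w = "\<lambda>p. filter ((\<le>) m) p"
  have eq: "?w (f # map (shift f) p) = f # map (shift f) v \<longleftrightarrow> ?w p = v" for p
    unfolding filter_eq_shift_iff[OF m(2)] using inj_shift by (simp add: inj_map_eq_map)
  have gd: "good (filter ((\<le>) f) p)" if "?w p = v" for p
  proof -
    have "good (?w p)" using that v by (simp add: words_def)
    then show ?thesis by (rule good_filter_mono) (use m in auto)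
  qed
  have hd: "hd p = hd v" if "p \<in> perms n" "?w p = v" "m \<le> hd p" for p
    using hd_filter[of p m] that perms_ne[of p n] m by auto
  have "high m (Suc n) (f # map (shift f) v) = psum (\<lambda>p. hd p = f \<and> ?w p = f # map (shift f) v) (Suc n)"
    unfolding high_def
  proof (rule psum_cong)
    fix p assume p: "p \<in> perms (Suc n)"
    then have "p \<noteq> []" using perms_ne by simp
    then show "(m \<le> hd p \<and> ?w p = f # map (shift f) v) = (hd p = f \<and> ?w p = f # map (shift f) v)"
      using hd_filter[of p m] m by auto
  qed
  also have "\<dots> = psum (\<lambda>p. f \<le> hd p \<and> good (filter ((\<le>) f) p) \<and> ?w (f # map (shift f) p) = f # map (shift f) v) n +
      q * psum (\<lambda>p. hd p < f \<and> ?w (f # map (shift f) p) = f # map (shift f) v) n"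
    using m by (intro psum_prepend) auto
  also have "\<dots> = psum (\<lambda>p. f \<le> hd p \<and> ?w p = v) n + q * psum (\<lambda>p. hd p < f \<and> ?w p = v) n"
    unfolding eq using gd by (auto intro!: arg_cong2[of _ _ _ _ "(+)"] psum_cong)
  also have "\<dots> = (if hd v < f then q * (high m n v + low m n v) else high m n v + q * low m n v)"
  proof (cases "hd v < f")
    case True
    have "psum (\<lambda>p. f \<le> hd p \<and> ?w p = v) n = 0"
      unfolding psum_def using hd True m by (intro sum.neutral) fastforce
    moreover have "psum (\<lambda>p. hd p < f \<and> ?w p = v) n = high m n v + low m n v"
      unfolding psum_split[of "\<lambda>p. hd p < f \<and> ?w p = v" n "\<lambda>p. m \<le> hd p"] high_def low_def
      using hd True m by (auto intro!: arg_cong2[of _ _ _ _ "(+)"] psum_cong)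
    ultimately show ?thesis using True by simp
  next
    case False
    have "psum (\<lambda>p. f \<le> hd p \<and> ?w p = v) n = high m n v"
      unfolding high_def using hd False m by (intro psum_cong) fastforce
    moreover have "psum (\<lambda>p. hd p < f \<and> ?w p = v) n = low m n v"
      unfolding low_def using hd False m by (intro psum_cong) fastforce
    ultimately show ?thesis using False by simp
  qed
  finally show ?thesis .
qed

text \<open>The relation satisfied by a linear functional of the polynomials \<open>X\<^sup>k\<^sup>-\<^sup>d Y\<^sup>d\<close> with
  \<open>X - Y = 1 - q\<close>; here \<open>k - d\<close> and \<open>d\<close> are the numbers of ascents and descents of a word.\<close>

definition linear_type :: "(nat \<Rightarrow> nat \<Rightarrow> 'a) \<Rightarrow> bool" where
  "linear_type \<phi> \<longleftrightarrow> (\<forall>k d. d \<le> k \<longrightarrow> \<phi> (Suc k) d = \<phi> (Suc k) (Suc d) + (1 - q) * \<phi> k d)"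

text \<open>A word on \<open>{m..m + k}\<close> has \<open>k + 1\<close> letters, so
  \<open>k\<close> counts its ascents and descents together and \<open>X\<close> depends on the word
  only through these two numbers.\<close>

definition graded :: "nat \<Rightarrow> (nat \<Rightarrow> nat list \<Rightarrow> 'a) \<Rightarrow> (nat \<Rightarrow> nat \<Rightarrow> 'a) \<Rightarrow> bool" where
  "graded m X \<phi> \<longleftrightarrow> linear_type \<phi> \<and> (\<forall>k. \<forall>w\<in>words m (m + k). X (m + k) w = \<phi> k (desc w))"

lemma gradedD: "graded m X \<phi> \<Longrightarrow> w \<in> words m (m + k) \<Longrightarrow> X (m + k) w = \<phi> k (desc w)"
  and graded_linear: "graded m X \<phi> \<Longrightarrow> d \<le> k \<Longrightarrow> \<phi> (Suc k) d = \<phi> (Suc k) (Suc d) + (1 - q) * \<phi> k d"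
  by (auto simp: graded_def linear_type_def)

lemma graded_sum:
  assumes "finite I" "\<And>i. i \<in> I \<Longrightarrow> graded m (X i) (\<phi> i)"
  shows "graded m (\<lambda>n w. \<Sum>i\<in>I. X i n w) (\<lambda>k d. \<Sum>i\<in>I. \<phi> i k d)"
  using assms unfolding graded_def linear_type_def
  by (simp add: sum_distrib_left flip: sum.distrib)

text \<open>The values of \<open>high\<close> that \<open>high_Cons\<close> predicts from the values
  \<phi> of \<open>low\<close>, using an ascent as long as there is one; for
  \<open>d = Suc k\<close> there are only descents. The value for one letter is
  \<open>b\<close>.\<close>

primrec high_type :: "(nat \<Rightarrow> nat \<Rightarrow> 'a) \<Rightarrow> 'a \<Rightarrow> nat \<Rightarrow> nat \<Rightarrow> 'a" where
  "high_type \<phi> b 0 d = b"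
| "high_type \<phi> b (Suc k) d =
    (if d \<le> k then high_type \<phi> b k d + q * \<phi> k d else q * (high_type \<phi> b k k + \<phi> k k))"

text \<open>Removing a descent gives the same value as removing an ascent. This consistency is what
  the linear relation of \<phi> provides.\<close>

lemma high_type_Suc_Suc:
  assumes "linear_type \<phi>" "d \<le> k"
  shows "high_type \<phi> b (Suc k) (Suc d) = q * (high_type \<phi> b k d + \<phi> k d)"
  using assms(2)
proof (induction k)
  case (Suc k)
  show ?case
  proof (cases "d = Suc k")
    case False
    then have d: "d \<le> k" using Suc.prems by simp
    have lin: "\<phi> (Suc k) d = \<phi> (Suc k) (Suc d) + (1 - q) * \<phi> k d"
      using assms(1) d by (simp add: linear_type_def)
    have "high_type \<phi> b (Suc (Suc k)) (Suc d) = high_type \<phi> b (Suc k) (Suc d) + q * \<phi> (Suc k) (Suc d)"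
      using d by (subst high_type.simps(2)) simp
    also have "\<dots> = q * (high_type \<phi> b k d + \<phi> k d) + q * \<phi> (Suc k) (Suc d)"
      using Suc.IH[OF d] by simp
    also have "\<dots> = q * (high_type \<phi> b (Suc k) d + \<phi> (Suc k) d)"
      using d unfolding lin by (simp add: algebra_simps)
    finally show ?thesis .
  qed simp
qed simp

text \<open>Induction on the word by its first step: an ascent matches the defining equation of
  \<open>high_type\<close>, a descent matches \<open>high_type_Suc_Suc\<close>. The difference of
  these two equations is the linear relation for \<psi>.\<close>

lemma graded_high:
  assumes m: "1 \<le> m" and low: "graded m (low m) \<phi>"
  defines "\<psi> \<equiv> high_type \<phi> (high m m [m])"
  shows "graded m (high m) \<psi>"
  unfolding graded_def
proof (intro conjI allI ballI)
  have lin: "linear_type \<phi>" using low by (simp add: graded_def)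
  show "linear_type \<psi>"
    unfolding linear_type_def
  proof (intro allI impI)
    fix k d :: nat assume d: "d \<le> k"
    show "\<psi> (Suc k) d = \<psi> (Suc k) (Suc d) + (1 - q) * \<psi> k d"
      using high_type_Suc_Suc[OF lin d, of "high m m [m]"] d
      by (simp add: \<psi>_def algebra_simps)
  qed
  fix k w assume "w \<in> words m (m + k)"
  then show "high m (m + k) w = \<psi> k (desc w)"
  proof (induction k arbitrary: w)
    case 0
    then have "set w = {m}" "length w = 1" using length_words[of w m 0] by (auto simp: words_def)
    then have "w = [m]" by (cases w) auto
    then show ?case by (simp add: \<psi>_def)
  next
    case (Suc k)
    then obtain f v where f: "m \<le> f" "f \<le> Suc (m + k)" "w = f # map (shift f) v" "v \<in> words m (m + k)"
      using words_SucE[of w m "m + k"] by auto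
    have v: "v \<noteq> []" using words_ne[OF f(4)] by simp
    have d: "desc w = (if hd v < f then 1 else 0) + desc v"
      unfolding f(3) using v by (rule desc_Cons_map_shift)
    have dk: "desc v \<le> k" using desc_words_le[OF f(4)] .
    have "high m (m + Suc k) w = (if hd v < f then q * (high m (m + k) v + low m (m + k) v)
        else high m (m + k) v + q * low m (m + k) v)"
      using high_Cons[OF m f(1,2) _ f(4)] f(3) by simp
    also have "\<dots> = (if hd v < f then q * (\<psi> k (desc v) + \<phi> k (desc v)) else \<psi> k (desc v) + q * \<phi> k (desc v))"
      using Suc.IH[OF f(4)] gradedD[OF low f(4)] by simp
    also have "\<dots> = \<psi> (Suc k) (desc w)"
    proof (cases "hd v < f")
      case True
      then show ?thesis
        using high_type_Suc_Suc[OF lin dk, of "high m m [m]"] unfolding d \<psi>_def by (simp only: if_True plus_1_eq_Suc)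
    next
      case False
      then show ?thesis using dk unfolding d \<psi>_def by simp
    qed
    finally show ?case .
  qed
qed

text \<open>By strong induction \<open>low m\<close> is graded: it is sorted by the first entry
  \<open>h < m\<close>, whose part is computed at the threshold \<open>Suc h\<close> from
  \<open>low h\<close> and \<open>high h\<close> and then carried up to \<open>m\<close> step by
  step. Since \<open>high m\<close> is then graded as well, the doubling rule can be checked word by
  word.\<close>

lemma catalytic_first_sum_two_extensions:
  assumes extensions: "\<And>m n w. w \<noteq> [] \<Longrightarrow> w \<in> words (Suc m) n \<Longrightarrow>
    \<exists>u v. desc u = desc w \<and> desc v = Suc (desc w) \<and>
      {x \<in> words m n. filter ((\<le>) (Suc m)) x = w} = {u, v}"
  shows "catalytic q first_sum"
proof -
  define from_first where "from_first h m n w = psum (\<lambda>p. hd p = h \<and> filter ((\<le>) m) p = w) n" for h m n w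
  have ext: "\<exists>u v. u \<noteq> v \<and> desc u = desc w \<and> desc v = Suc (desc w) \<and> u \<in> words m n \<and> v \<in> words m n \<and>
      {x \<in> words m n. filter ((\<le>) (Suc m)) x = w} = {u, v}"
    if m: "Suc m \<le> n" and w: "w \<in> words (Suc m) n" for m n w
  proof -
    obtain u v where uv: "desc u = desc w" "desc v = Suc (desc w)"
      "{x \<in> words m n. filter ((\<le>) (Suc m)) x = w} = {u, v}"
      using extensions[OF words_ne[OF w m] w] by blast
    have "{u, v} \<subseteq> words m n" unfolding uv(3)[symmetric] by blast
    moreover have "u \<noteq> v" using uv(1,2) by auto
    ultimately show ?thesis using uv by (intro exI[of _ u] exI[of _ v]) simp
  qed
  \<comment> \<open>Such a permutation arises by prepending \<open>h\<close>. Its entries above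
    \<open>h\<close> are, lowered by one, the entries \<open>\<ge> h\<close> of the shorter
    permutation.\<close>
  have from_first_base: "graded (Suc h) (from_first h (Suc h)) (\<lambda>k d. \<psi> k d + q * \<phi> k d)"
    if h: "1 \<le> h" and low: "graded h (low h) \<phi>" and high: "graded h (high h) \<psi>" for h \<phi> \<psi>
    unfolding graded_def
  proof (intro conjI allI ballI)
    show "linear_type (\<lambda>k d. \<psi> k d + q * \<phi> k d)"
      unfolding linear_type_def
    proof (intro allI impI)
      fix k d :: nat assume d: "d \<le> k"
      show "\<psi> (Suc k) d + q * \<phi> (Suc k) d =
          \<psi> (Suc k) (Suc d) + q * \<phi> (Suc k) (Suc d) + (1 - q) * (\<psi> k d + q * \<phi> k d)"
        unfolding graded_linear[OF low d] graded_linear[OF high d] by (simp add: algebra_simps)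
    qed
    fix k w assume "w \<in> words (Suc h) (Suc h + k)"
    then obtain v where v: "v \<in> words h (h + k)" "w = map Suc v"
      using bij_betw_imp_surj_on[OF bij_betw_map_Suc_words[of h "h + k"]] by auto
    have eq: "filter ((\<le>) (Suc h)) (h # map (shift h) p) = w \<longleftrightarrow> filter ((\<le>) h) p = v" for p
    proof -
      have "filter ((\<le>) (Suc h)) (h # map (shift h) p) = map (shift h) (filter ((\<le>) h) p)"
        by (simp add: filter_map o_def Suc_le_eq)
      also have "\<dots> = map Suc (filter ((\<le>) h) p)" by (simp add: shift_def)
      finally show ?thesis unfolding v(2) by (simp add: inj_map_eq_map)
    qed
    have "from_first h (Suc h) (Suc (h + k)) w =
        psum (\<lambda>p. h \<le> hd p \<and> good (filter ((\<le>) h) p) \<and> filter ((\<le>) h) p = v) (h + k) +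
        q * psum (\<lambda>p. hd p < h \<and> filter ((\<le>) h) p = v) (h + k)"
      unfolding from_first_def using h by (subst psum_prepend) (auto simp: eq simp del: filter.simps)
    also have "psum (\<lambda>p. h \<le> hd p \<and> good (filter ((\<le>) h) p) \<and> filter ((\<le>) h) p = v) (h + k) = high h (h + k) v"
      unfolding high_def using v(1) by (intro psum_cong) (auto simp: words_def)
    finally show "from_first h (Suc h) (Suc h + k) w = \<psi> k (desc w) + q * \<phi> k (desc w)"
      using gradedD[OF low v(1)] gradedD[OF high v(1)] v(2) by (simp add: low_def desc_map_Suc)
  qed
  \<comment> \<open>At the lower threshold \<open>m\<close> the word of large entries is one of the
    two extensions of \<open>w\<close>, and the sum of the two values again obeys the linear
    relation.\<close>
  have from_first_step: "graded (Suc m) (from_first h (Suc m)) (\<lambda>k d. \<chi> (Suc k) d + \<chi> (Suc k) (Suc d))"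
    if h: "1 \<le> h" "h < m" and ff: "graded m (from_first h m) \<chi>" for h m \<chi>
    unfolding graded_def
  proof (intro conjI allI ballI)
    show "linear_type (\<lambda>k d. \<chi> (Suc k) d + \<chi> (Suc k) (Suc d))"
      unfolding linear_type_def
    proof (intro allI impI)
      fix k d :: nat assume "d \<le> k"
      then have d: "d \<le> Suc k" "Suc d \<le> Suc k" by auto
      show "\<chi> (Suc (Suc k)) d + \<chi> (Suc (Suc k)) (Suc d) =
          \<chi> (Suc (Suc k)) (Suc d) + \<chi> (Suc (Suc k)) (Suc (Suc d)) + (1 - q) * (\<chi> (Suc k) d + \<chi> (Suc k) (Suc d))"
        unfolding graded_linear[OF ff d(1)] graded_linear[OF ff d(2)] by (simp add: algebra_simps)
    qed
    fix k w assume w: "w \<in> words (Suc m) (Suc m + k)"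
    let ?n = "m + Suc k"
    obtain u v where uv: "u \<noteq> v" "desc u = desc w" "desc v = Suc (desc w)" "u \<in> words m ?n" "v \<in> words m ?n"
      "{x \<in> words m ?n. filter ((\<le>) (Suc m)) x = w} = {u, v}"
      using ext[of m ?n w] w by auto
    have split: "filter ((\<le>) (Suc m)) p = w \<longleftrightarrow> filter ((\<le>) m) p = u \<or> filter ((\<le>) m) p = v"
      if p: "p \<in> perms ?n" "hd p = h" for p
    proof -
      have mem: "filter ((\<le>) m) p \<in> words m ?n"
        using p h good_filter_hd_less[of p ?n m] by (intro filter_mem_words) auto
      have fil: "filter ((\<le>) (Suc m)) p = filter ((\<le>) (Suc m)) (filter ((\<le>) m) p)"
        by (auto intro: filter_cong)
      have "filter ((\<le>) m) p \<in> {x \<in> words m ?n. filter ((\<le>) (Suc m)) x = w} \<longleftrightarrow>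
          filter ((\<le>) m) p = u \<or> filter ((\<le>) m) p = v"
        unfolding uv(6) by simp
      then show ?thesis unfolding fil using mem by (simp only: mem_Collect_eq simp_thms)
    qed
    have "from_first h (Suc m) ?n w = from_first h m ?n u + from_first h m ?n v"
      unfolding from_first_def
      unfolding psum_split[of "\<lambda>p. hd p = h \<and> filter ((\<le>) (Suc m)) p = w" ?n "\<lambda>p. filter ((\<le>) m) p = u"]
      using split uv(1) by (auto intro!: arg_cong2[of _ _ _ _ "(+)"] psum_cong)
    then show "from_first h (Suc m) (Suc m + k) w = \<chi> (Suc k) (desc w) + \<chi> (Suc k) (Suc (desc w))"
      using gradedD[OF ff uv(4)] gradedD[OF ff uv(5)] uv(2,3) by simp
  qed
  have from_first: "\<exists>\<chi>. graded m (from_first h m) \<chi>"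
    if "1 \<le> h" "h < m" "graded h (low h) \<phi>" for h m \<phi>
  proof -
    have "Suc h \<le> m" using that(2) by simp
    then show ?thesis
    proof (induction m rule: dec_induct)
      case base
      show ?case using from_first_base[OF that(1,3) graded_high[OF that(1,3)]] by blast
    next
      case (step m)
      then show ?case using from_first_step[OF that(1), of m] by auto
    qed
  qed
  have low: "\<exists>\<phi>. graded m (low m) \<phi>" if "1 \<le> m" for m
    using that
  proof (induction m rule: less_induct)
    case (less m)
    have "\<exists>\<chi>. graded m (from_first h m) \<chi>" if "h \<in> {1..<m}" for h
      using less.IH[of h] from_first[of h m] that by auto
    then obtain \<chi> where "\<And>h. h \<in> {1..<m} \<Longrightarrow> graded m (from_first h m) (\<chi> h)" by metis
    then have "graded m (\<lambda>n w. \<Sum>h = 1..<m. from_first h m n w) (\<lambda>k d. \<Sum>h = 1..<m. \<chi> h k d)"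
      by (intro graded_sum) auto
    moreover have "low m (m + k) w = (\<Sum>h = 1..<m. from_first h m (m + k) w)" for k w
    proof -
      have "low m (m + k) w = (\<Sum>h = 1..<m. psum (\<lambda>p. (hd p < m \<and> filter ((\<le>) m) p = w) \<and> hd p = h) (m + k))"
        unfolding low_def using hd_perms[of _ "m + k"] less.prems by (intro psum_partition) auto
      also have "\<dots> = (\<Sum>h = 1..<m. from_first h m (m + k) w)"
        unfolding from_first_def by (intro sum.cong psum_cong) auto
      finally show ?thesis .
    qed
    ultimately show ?case unfolding graded_def by auto
  qed
  show ?thesis
  proof (rule catalytic_first_sum)
    fix n m :: nat assume m: "1 \<le> m" "m \<le> n"
    define k where "k = n - m"
    have n: "n = m + k" using m by (simp add: k_def)
    let ?fil = "\<lambda>p. filter ((\<le>) m) p"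
    obtain \<phi> where \<phi>: "graded m (low m) \<phi>" using low m by blast
    define \<psi> where "\<psi> = high_type \<phi> (high m m [m])"
    have \<psi>: "graded m (high m) \<psi>" unfolding \<psi>_def using m(1) \<phi> by (rule graded_high)
    have sum_words: "(\<Sum>w\<in>words m N. psum (\<lambda>p. Q p \<and> ?fil p = w) N) = psum (\<lambda>p. Q p \<and> good (?fil p)) N" for Q N
    proof -
      have "psum (\<lambda>p. Q p \<and> good (?fil p)) N = (\<Sum>w\<in>words m N. psum (\<lambda>p. (Q p \<and> good (?fil p)) \<and> ?fil p = w) N)"
        using filter_mem_words m by (intro psum_partition) auto
      also have "\<dots> = (\<Sum>w\<in>words m N. psum (\<lambda>p. Q p \<and> ?fil p = w) N)"
        by (intro sum.cong psum_cong) (auto simp: words_def)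
      finally show ?thesis by simp
    qed
    have "high_sum (Suc n) m = (\<Sum>x\<in>words m (Suc n). high m (Suc n) x)"
      unfolding high_sum_def high_def by (rule sum_words[symmetric])
    \<comment> \<open>Words are grouped by what is left after deleting the letter \<open>m\<close>;
      each group consists of two extensions.\<close>
    also have "\<dots> = (\<Sum>w\<in>words (Suc m) (Suc n). \<Sum>x | x \<in> words m (Suc n) \<and> filter ((\<le>) (Suc m)) x = w. high m (Suc n) x)"
    proof (rule sum.group[symmetric])
      show "(\<lambda>x. filter ((\<le>) (Suc m)) x) ` words m (Suc n) \<subseteq> words (Suc m) (Suc n)"
        by (auto simp: words_def intro: good_subseq)
    qed simp_all
    also have "\<dots> = (\<Sum>w\<in>words (Suc m) (Suc n). \<psi> (Suc k) (desc w) + \<psi> (Suc k) (Suc (desc w)))"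
    proof (intro sum.cong refl)
      fix w assume w: "w \<in> words (Suc m) (Suc n)"
      obtain u v where uv: "u \<noteq> v" "desc u = desc w" "desc v = Suc (desc w)" "u \<in> words m (Suc n)" "v \<in> words m (Suc n)"
        "{x \<in> words m (Suc n). filter ((\<le>) (Suc m)) x = w} = {u, v}"
        using ext[of m "Suc n" w] w m by auto
      show "(\<Sum>x | x \<in> words m (Suc n) \<and> filter ((\<le>) (Suc m)) x = w. high m (Suc n) x) =
          \<psi> (Suc k) (desc w) + \<psi> (Suc k) (Suc (desc w))"
        unfolding uv(6) using uv(1-5) gradedD[OF \<psi>, of _ "Suc k"] n by simp
    qed
    \<comment> \<open>Lowering all letters by one identifies the two sets of words and preserves
      descents.\<close>
    also have "\<dots> = (\<Sum>w\<in>words m n. \<psi> (Suc k) (desc w) + \<psi> (Suc k) (Suc (desc w)))"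
      by (subst sum.reindex_bij_betw[OF bij_betw_map_Suc_words, symmetric]) (simp add: desc_map_Suc)
    \<comment> \<open>The two terms are rewritten by the equations of \<open>high_type\<close> for
      an added ascent and an added descent.\<close>
    also have "\<dots> = (\<Sum>w\<in>words m n. high m n w + q * low m n w + q * (high m n w + low m n w))"
    proof (intro sum.cong refl)
      fix w assume w: "w \<in> words m n"
      have "desc w \<le> k" using desc_words_le w n by blast
      moreover have "linear_type \<phi>" using \<phi> by (simp add: graded_def)
      ultimately show "\<psi> (Suc k) (desc w) + \<psi> (Suc k) (Suc (desc w)) =
          high m n w + q * low m n w + q * (high m n w + low m n w)"
        using high_type_Suc_Suc[of \<phi> "desc w" k "high m m [m]"]
          gradedD[OF \<phi>, of w k] gradedD[OF \<psi>, of w k] w n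
        unfolding \<psi>_def[symmetric] by (simp add: \<psi>_def)
    qed
    also have "\<dots> = psum (\<lambda>p. m \<le> hd p \<and> good (?fil p)) n + q * psum (\<lambda>p. hd p < m \<and> good (?fil p)) n +
        q * (psum (\<lambda>p. m \<le> hd p \<and> good (?fil p)) n + psum (\<lambda>p. hd p < m \<and> good (?fil p)) n)"
      by (simp add: sum.distrib high_def low_def sum_words flip: sum_distrib_left)
    also have "psum (\<lambda>p. m \<le> hd p \<and> good (?fil p)) n + psum (\<lambda>p. hd p < m \<and> good (?fil p)) n = psum (\<lambda>p. good (?fil p)) n"
      unfolding psum_split[of "\<lambda>p. good (?fil p)" n "\<lambda>p. m \<le> hd p"]
      by (intro arg_cong2[of _ _ _ _ "(+)"] psum_cong) auto
    also have "psum (\<lambda>p. hd p < m \<and> good (?fil p)) n = psum (\<lambda>p. hd p < m) n"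
      using good_filter_hd_less m by (intro psum_cong) auto
    finally show "high_sum (Suc n) m = first_sum (Suc n) m + q * psum (\<lambda>p. good (?fil p)) n"
      using first_sum_Suc_psum[of n m] m by simp
  qed
qed

end

subsection \<open>The six pairs\<close>

lemma subseq_append_Cons_cases:
  assumes "subseq xs (as @ m # bs)"
  obtains "subseq xs (as @ bs)" | us vs where "xs = us @ m # vs" "subseq us as" "subseq vs bs"
proof -
  obtain us vs where xs: "xs = us @ vs" "subseq us as" "subseq vs (m # bs)"
    using assms by (auto simp: subseq_append_iff)
  show thesis
  proof (cases vs)
    case Nil
    then show thesis using xs that(1) by (simp add: subseq_rev_drop_many)
  next
    case (Cons y ys)
    show thesis
    proof (cases "y = m")
      case True
      then show thesis using xs Cons that(2)[of us ys] by simp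
    next
      case False
      then have "subseq vs bs" using xs Cons by simp
      then show thesis using xs that(1) by (simp add: list_emb_append_mono)
    qed
  qed
qed

lemma subseq_append_Cons_min:
  "subseq us as \<Longrightarrow> subseq vs bs \<Longrightarrow> subseq (us @ m # vs) (as @ m # bs)"
  by (intro list_emb_append_mono) auto

lemma filter_ge_Suc_eq_iff:
  assumes "distinct x" "set x = {m..n}" "m \<le> n"
  shows "filter ((\<le>) (Suc m)) x = w \<longleftrightarrow> (\<exists>as bs. w = as @ bs \<and> x = as @ m # bs)"
proof
  assume w: "filter ((\<le>) (Suc m)) x = w"
  have "m \<in> set x" using assms by simp
  then obtain as bs where x: "x = as @ m # bs" by (meson split_list)
  have "m < y" if "y \<in> set as \<union> set bs" for y
  proof -
    have "y \<in> {m..n}" using that x assms(2) by auto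
    moreover have "y \<noteq> m" using that x assms(1) by auto
    ultimately show ?thesis by simp
  qed
  then have "filter ((\<le>) (Suc m)) as = as" "filter ((\<le>) (Suc m)) bs = bs"
    by (simp_all add: filter_id_conv Suc_le_eq)
  then have "filter ((\<le>) (Suc m)) x = as @ bs" unfolding x by simp
  then show "\<exists>as bs. w = as @ bs \<and> x = as @ m # bs" using w x by blast
next
  assume "\<exists>as bs. w = as @ bs \<and> x = as @ m # bs"
  then obtain as bs where w: "w = as @ bs" and x: "x = as @ m # bs" by blast
  have "m < y" if "y \<in> set as \<union> set bs" for y
  proof -
    have "y \<in> {m..n}" using that x assms(2) by auto
    moreover have "y \<noteq> m" using that x assms(1) by auto
    ultimately show ?thesis by simp
  qed
  then have "filter ((\<le>) (Suc m)) as = as" "filter ((\<le>) (Suc m)) bs = bs"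
    by (simp_all add: filter_id_conv Suc_le_eq)
  then show "filter ((\<le>) (Suc m)) x = w" unfolding x w by simp
qed

text \<open>The step into the minimum is a descent whenever it exists, the step out of it never is,
  and the former step from \<open>xs\<close> to \<open>ys\<close> disappears.\<close>

lemma desc_append_min:
  assumes "\<And>x. x \<in> set xs \<union> set ys \<Longrightarrow> m < x"
  shows "desc (xs @ m # ys) = desc xs + (if xs = [] then 0 else 1) + desc ys"
  using assms
proof (induction xs)
  case Nil
  then show ?case by (cases "ys = []") (auto simp: desc_Cons dest: order.asym)
next
  case (Cons x xs)
  then have IH: "desc (xs @ m # ys) = desc xs + (if xs = [] then 0 else 1) + desc ys" and "m < x" by auto
  then show ?case by (cases xs) (auto simp: desc_Cons)
qed

section \<open>Criteria for two admissible heads and for two positions of a new minimum\<close>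

context triple_avoidance
begin

text \<open>The case of \<open>catalytic_first_sum_two_heads\<close> where the two values depend
  only on \<open>m\<close>, \<open>n\<close> and the head \<open>g\<close>. Any other value forms a
  forbidden triple with \<open>g\<close> and a later \<open>c\<close>. For \<open>lo\<close> and
  \<open>hi\<close>, a forbidden triple \<open>f, b, c\<close> would already be forbidden with
  \<open>g\<close> in place of \<open>f\<close>.\<close>

lemma catalytic_first_sum_lo_hi:
  fixes lo hi :: "nat \<Rightarrow> nat \<Rightarrow> nat \<Rightarrow> nat"
  assumes bounds: "\<And>m n g. m \<le> g \<Longrightarrow> g \<le> n \<Longrightarrow>
      m \<le> lo m n g \<and> lo m n g \<le> g \<and> g < hi m n g \<and> hi m n g \<le> Suc n"
    and other: "\<And>m n g f. m \<le> g \<Longrightarrow> g \<le> n \<Longrightarrow> m \<le> f \<Longrightarrow> f \<le> Suc n \<Longrightarrow> f \<noteq> lo m n g \<Longrightarrow>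
      f \<noteq> hi m n g \<Longrightarrow> \<exists>c\<in>{m..n}. c \<noteq> g \<and> R f (shift f g) (shift f c)"
    and lo_hi: "\<And>m n g f b c. f = lo m n g \<or> f = hi m n g \<Longrightarrow> b \<in> {m..n} \<Longrightarrow> c \<in> {m..n} \<Longrightarrow>
      b \<noteq> c \<Longrightarrow> c \<noteq> g \<Longrightarrow> b = g \<or> \<not> R g b c \<Longrightarrow> \<not> R f (shift f b) (shift f c)"
  shows "catalytic q first_sum"
proof (rule catalytic_first_sum_two_heads)
  fix m n w assume w: "w \<noteq> []" "distinct w" "set w = {m..n}" "good w"
  obtain g t where gt: "w = g # t" using w(1) by (cases w) auto
  have "g \<in> set w" using gt by simp
  then have g: "m \<le> g" "g \<le> n" using w(3) by auto
  show "\<exists>l h. m \<le> l \<and> l \<le> hd w \<and> hd w < h \<and> h \<le> Suc n \<and>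
      (\<forall>f\<in>{m..Suc n}. good (f # map (shift f) w) \<longleftrightarrow> f = l \<or> f = h)"
  proof (intro exI conjI ballI)
    show "m \<le> lo m n g" "lo m n g \<le> hd w" "hd w < hi m n g" "hi m n g \<le> Suc n"
      using bounds[OF g] gt by auto
    fix f assume f: "f \<in> {m..Suc n}"
    show "good (f # map (shift f) w) \<longleftrightarrow> f = lo m n g \<or> f = hi m n g"
    proof
      assume good: "good (f # map (shift f) w)"
      show "f = lo m n g \<or> f = hi m n g"
      proof (rule ccontr)
        assume "\<not> (f = lo m n g \<or> f = hi m n g)"
        then obtain c where c: "c \<in> {m..n}" "c \<noteq> g" "R f (shift f g) (shift f c)"
          using other[OF g, of f] f by auto
        have "c \<in> set w" unfolding w(3) by (rule c(1))
        then have "c \<in> set t" using c(2) gt by simp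
        then have "subseq [f, shift f g, shift f c] (f # map (shift f) w)"
          using gt by (simp add: subseq_singleton_left)
        then show False using good c(3) unfolding good_def by blast
      qed
    next
      assume lh: "f = lo m n g \<or> f = hi m n g"
      show "good (f # map (shift f) w)"
        unfolding good_def
      proof (intro allI impI)
        fix a b c assume s: "subseq [a, b, c] (f # map (shift f) w)"
        show "\<not> R a b c"
        proof (cases "a = f")
          case False
          then have "subseq [a, b, c] (map (shift f) w)" using s by simp
          then show ?thesis
            using w(4) good_map[OF strict_mono_shift, of f w] unfolding good_def by blast
        next
          case True
          then have "subseq [b, c] (map (shift f) w)" using s by simp
          then obtain b' c' where bc: "b = shift f b'" "c = shift f c'" "subseq [b', c'] w"
            unfolding subseq_map_conv Cons_eq_map_conv by blast
          have mem: "b' \<in> {m..n}" "c' \<in> {m..n}" using subseq_set[OF bc(3)] w(3) by auto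
          have "b' \<noteq> c'"
          proof
            assume "b' = c'"
            then obtain N where "[c', c'] = nths w N" using bc(3) by (auto simp: subseq_conv_nths)
            then have "distinct [c', c']" using w(2) by (metis distinct_nthsI)
            then show False by simp
          qed
          moreover have "c' \<in> set t"
            using bc(3) gt by (cases "b' = g") (auto simp: subseq_singleton_left dest: subseq_set)
          then have "c' \<noteq> g" using w(2) gt by auto
          moreover have "b' = g \<or> \<not> R g b' c'"
          proof (cases "b' = g")
            case False
            then have "subseq [g, b', c'] w" using bc(3) gt by simp
            then show ?thesis using w(4) unfolding good_def by blast
          qed simp
          ultimately show ?thesis using lo_hi[OF lh mem] True bc by blast
        qed
      qed
    qed
  qed
qed

text \<open>A triple through the inserted letter has it in first, middle or last place.\<close>

lemma good_append_Cons_iff: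
  "good (as @ m # bs) \<longleftrightarrow> good (as @ bs) \<and> (\<forall>b c. subseq [b, c] bs \<longrightarrow> \<not> R m b c) \<and>
    (\<forall>a\<in>set as. \<forall>c\<in>set bs. \<not> R a m c) \<and> (\<forall>a b. subseq [a, b] as \<longrightarrow> \<not> R a b m)"
  (is "?L \<longleftrightarrow> ?R")
proof
  assume good: ?L
  have sub: "subseq us as \<Longrightarrow> subseq vs bs \<Longrightarrow> us @ m # vs = [a, b, c] \<Longrightarrow> \<not> R a b c" for us vs a b c
    using good subseq_append_Cons_min[of us as vs bs m] unfolding good_def by metis
  show ?R
  proof (intro conjI allI ballI impI)
    show "good (as @ bs)" using good by (rule good_subseq) (intro list_emb_append_mono; simp add: list_emb_Cons)
    show "\<not> R m b c" if "subseq [b, c] bs" for b c using sub[of "[]" "[b, c]"] that by simp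
    show "\<not> R a m c" if "a \<in> set as" "c \<in> set bs" for a c
      using sub[of "[a]" "[c]"] that by (simp add: subseq_singleton_left)
    show "\<not> R a b m" if "subseq [a, b] as" for a b using sub[of "[a, b]" "[]"] that by simp
  qed
next
  assume R: ?R
  show ?L
    unfolding good_def
  proof (intro allI impI)
    fix a b c assume "subseq [a, b, c] (as @ m # bs)"
    then show "\<not> R a b c"
    proof (cases rule: subseq_append_Cons_cases)
      case 1
      then show ?thesis using R by (simp add: good_def)
    next
      case (2 us vs)
      consider "us = []" "a = m" "vs = [b, c]" | "us = [a]" "b = m" "vs = [c]" | "us = [a, b]" "c = m" "vs = []"
        using 2(1) by (cases us; cases "tl us"; cases "tl (tl us)") auto
      then show ?thesis using R 2 by cases (auto simp: subseq_singleton_left)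
    qed
  qed
qed

text \<open>Extensions of \<open>w\<close> by a new minimum are insertions of \<open>m\<close>, so
  the two admissible ones are given by splittings of \<open>w\<close>.\<close>

lemma catalytic_first_sum_insert_min:
  assumes insert_min: "\<And>m w. w \<noteq> [] \<Longrightarrow> distinct w \<Longrightarrow> (\<And>x. x \<in> set w \<Longrightarrow> m < x) \<Longrightarrow> good w \<Longrightarrow>
    \<exists>as bs as' bs'. as @ bs = w \<and> as' @ bs' = w \<and>
      desc (as @ m # bs) = desc w \<and> desc (as' @ m # bs') = Suc (desc w) \<and>
      (\<forall>cs ds. cs @ ds = w \<longrightarrow> good (cs @ m # ds) \<longleftrightarrow> (cs, ds) = (as, bs) \<or> (cs, ds) = (as', bs'))"
  shows "catalytic q first_sum"
proof (rule catalytic_first_sum_two_extensions)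
  fix m n w assume w: "w \<noteq> []" "w \<in> words (Suc m) n"
  have gt: "m < x" if "x \<in> set w" for x using w(2) that by (auto simp: words_def)
  have "m \<le> n" using w by (cases "m \<le> n") (auto simp: words_def)
  have ins: "as @ m # bs \<in> words m n \<longleftrightarrow> good (as @ m # bs)" if "as @ bs = w" for as bs
  proof -
    have d: "distinct (as @ bs)" "set (as @ bs) = {Suc m..n}" using w(2) that by (simp_all add: words_def)
    have "m \<notin> set (as @ bs)" unfolding d(2) by simp
    then have "distinct (as @ m # bs)" using d(1) by simp
    moreover have "set (as @ m # bs) = insert m (set (as @ bs))" by auto
    then have "set (as @ m # bs) = {m..n}" unfolding d(2) atLeastAtMost_insertL[OF \<open>m \<le> n\<close>] .
    ultimately show ?thesis by (simp add: words_def)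
  qed
  have "distinct w" "good w" using w(2) by (auto simp: words_def)
  then obtain as bs as' bs' where ab: "as @ bs = w" "as' @ bs' = w"
      "desc (as @ m # bs) = desc w" "desc (as' @ m # bs') = Suc (desc w)"
    and iff: "\<And>cs ds. cs @ ds = w \<Longrightarrow> good (cs @ m # ds) \<longleftrightarrow> (cs, ds) = (as, bs) \<or> (cs, ds) = (as', bs')"
    using insert_min[OF w(1), of m] gt by metis
  have "{x \<in> words m n. filter ((\<le>) (Suc m)) x = w} = {as @ m # bs, as' @ m # bs'}"
  proof (intro equalityI subsetI)
    fix x assume x: "x \<in> {x \<in> words m n. filter ((\<le>) (Suc m)) x = w}"
    then obtain cs ds where cd: "w = cs @ ds" "x = cs @ m # ds"
      using filter_ge_Suc_eq_iff[of x m n w] \<open>m \<le> n\<close> by (auto simp: words_def)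
    then show "x \<in> {as @ m # bs, as' @ m # bs'}" using iff[of cs ds] x by (auto simp: words_def)
  next
    fix x assume "x \<in> {as @ m # bs, as' @ m # bs'}"
    then obtain cs ds where cd: "cs @ ds = w" "x = cs @ m # ds" "(cs, ds) = (as, bs) \<or> (cs, ds) = (as', bs')"
      using ab by blast
    then have "x \<in> words m n" using iff ins by blast
    moreover from this have "filter ((\<le>) (Suc m)) x = w"
      using filter_ge_Suc_eq_iff[of x m n w] \<open>m \<le> n\<close> cd by (auto simp: words_def)
    ultimately show "x \<in> {x \<in> words m n. filter ((\<le>) (Suc m)) x = w}" by simp
  qed
  then show "\<exists>u v. desc u = desc w \<and> desc v = Suc (desc w) \<and>
      {x \<in> words m n. filter ((\<le>) (Suc m)) x = w} = {u, v}"
    using ab(3,4) by blast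
qed

lemma sum_desc_hd_perms:
  assumes "1 \<le> n"
  shows "(\<Sum>p\<in>perms n. q ^ desc p * v ^ hd p) = (\<Sum>m = 1..n. first_sum n m * v ^ m)"
proof -
  have "(\<Sum>m = 1..n. first_sum n m * v ^ m) =
      (\<Sum>p\<in>perms n. \<Sum>m = 1..n. if hd p = m then q ^ desc p * v ^ m else 0)"
    unfolding first_sum_def psum_def sum_distrib_right
    by (subst sum.swap) (auto intro!: sum.cong)
  also have "\<dots> = (\<Sum>p\<in>perms n. q ^ desc p * v ^ hd p)"
    using hd_perms[OF _ assms] by (intro sum.cong refl) (simp add: sum.delta)
  finally show ?thesis by simp
qed

end

lemma sum_dist_last:
  fixes q v :: "'a::comm_ring_1"
  assumes "1 \<le> n"
  shows "(\<Sum>e\<in>avoiding_inversion_sequences n. q ^ (dist_values e - 1) * v ^ last e) =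
    (\<Sum>m = 1..n. inv_last q n m n * v ^ m)"
proof -
  let ?I = "avoiding_inversion_sequences n"
  have last: "last e \<in> {1..n}" if "e \<in> ?I" for e
  proof -
    have "e \<noteq> []" using length_avoiding_inversion_sequences[OF that] assms by auto
    then show ?thesis using avoiding_inversion_sequences_bounds[OF that, of "last e"] by simp
  qed
  have "(\<Sum>e\<in>?I. q ^ (dist_values e - 1) * v ^ last e) =
      (\<Sum>m = 1..n. \<Sum>e | e \<in> ?I \<and> last e = m. q ^ (dist_values e - 1) * v ^ last e)"
    using last finite_avoiding_inversion_sequences by (intro sum.group[symmetric]) auto
  also have "\<dots> = (\<Sum>m = 1..n. inv_last q n m n * v ^ m)"
    unfolding inv_last_def sum_distrib_right
  proof (intro sum.cong refl)
    fix m
    show "{e \<in> ?I. last e = m} = {e \<in> ?I. last e = m \<and> (\<forall>x\<in>set e. x \<le> n)}"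
      using avoiding_inversion_sequences_bounds(2) by blast
  qed auto
  finally show ?thesis .
qed

section \<open>The recurrence for each of the six pairs\<close>

definition p132 :: "nat \<Rightarrow> nat \<Rightarrow> nat \<Rightarrow> bool" where "p132 a b c \<longleftrightarrow> a < c \<and> c < b"
definition p213 :: "nat \<Rightarrow> nat \<Rightarrow> nat \<Rightarrow> bool" where "p213 a b c \<longleftrightarrow> b < a \<and> a < c"
definition p231 :: "nat \<Rightarrow> nat \<Rightarrow> nat \<Rightarrow> bool" where "p231 a b c \<longleftrightarrow> c < a \<and> a < b"
definition p312 :: "nat \<Rightarrow> nat \<Rightarrow> nat \<Rightarrow> bool" where "p312 a b c \<longleftrightarrow> b < c \<and> c < a"

lemmas pattern_defs = p132_def p213_def p231_def p312_def

lemma triple_avoidance_patterns: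
  "triple_avoidance (\<lambda>a b c. p132 a b c \<or> p213 a b c)"
  "triple_avoidance (\<lambda>a b c. p132 a b c \<or> p231 a b c)"
  "triple_avoidance (\<lambda>a b c. p132 a b c \<or> p312 a b c)"
  "triple_avoidance (\<lambda>a b c. p213 a b c \<or> p231 a b c)"
  "triple_avoidance (\<lambda>a b c. p213 a b c \<or> p312 a b c)"
  "triple_avoidance (\<lambda>a b c. p231 a b c \<or> p312 a b c)"
  by (simp_all add: triple_avoidance_def pattern_defs strict_mono_less)

lemma catalytic_132_213:
  "catalytic q (triple_avoidance.first_sum (\<lambda>a b c. p132 a b c \<or> p213 a b c) q)"
proof (rule triple_avoidance.catalytic_first_sum_lo_hi[OF triple_avoidance_patterns(1),
      where lo = "\<lambda>m n g. g" and hi = "\<lambda>m n g. Suc n"], goal_cases)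
  case (2 m n g f)
  \<comment> \<open>For \<open>f < g\<close> the triple \<open>f, g + 1, f + 1\<close> has type 132;
    for \<open>g < f \<le> n\<close> the triple \<open>f, g, f + 1\<close> has type 213.\<close>
  then show ?case by (intro bexI[of _ f]) (auto simp: pattern_defs shift_def)
qed (auto simp: pattern_defs shift_def split: if_splits)

lemma catalytic_132_312:
  "catalytic q (triple_avoidance.first_sum (\<lambda>a b c. p132 a b c \<or> p312 a b c) q)"
proof (rule triple_avoidance.catalytic_first_sum_lo_hi[OF triple_avoidance_patterns(3),
      where lo = "\<lambda>m n g. g" and hi = "\<lambda>m n g. Suc g"], goal_cases)
  case (2 m n g f)
  \<comment> \<open>For \<open>f < g\<close> the triple \<open>f, g + 1, f + 1\<close> has type 132;
    for \<open>f > g + 1\<close> the triple \<open>f, g, g + 1\<close> has type 312.\<close>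
  then show ?case
    by (intro bexI[of _ "if f < g then f else Suc g"]) (auto simp: pattern_defs shift_def)
qed (auto simp: pattern_defs shift_def split: if_splits)

lemma catalytic_213_231:
  "catalytic q (triple_avoidance.first_sum (\<lambda>a b c. p213 a b c \<or> p231 a b c) q)"
proof (rule triple_avoidance.catalytic_first_sum_lo_hi[OF triple_avoidance_patterns(4),
      where lo = "\<lambda>m n g. m" and hi = "\<lambda>m n g. Suc n"], goal_cases)
  case (2 m n g f)
  \<comment> \<open>For \<open>g < f \<le> n\<close> the triple \<open>f, g, n + 1\<close> has type
    213; for \<open>m < f \<le> g\<close> the triple \<open>f, g + 1, m\<close> has type
    231.\<close>
  then show ?case
    by (intro bexI[of _ "if g < f then n else m"]) (auto simp: pattern_defs shift_def)
qed (auto simp: pattern_defs shift_def split: if_splits)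

lemma catalytic_231_312:
  "catalytic q (triple_avoidance.first_sum (\<lambda>a b c. p231 a b c \<or> p312 a b c) q)"
proof (rule triple_avoidance.catalytic_first_sum_lo_hi[OF triple_avoidance_patterns(6),
      where lo = "\<lambda>m n g. m" and hi = "\<lambda>m n g. Suc g"], goal_cases)
  case (2 m n g f)
  \<comment> \<open>For \<open>m < f \<le> g\<close> the triple \<open>f, g + 1, m\<close> has type
    231; for \<open>f > g + 1\<close> the triple \<open>f, g, g + 1\<close> has type 312.\<close>
  then show ?case
    by (intro bexI[of _ "if f \<le> g then m else Suc g"]) (auto simp: pattern_defs shift_def)
qed (auto simp: pattern_defs shift_def split: if_splits)

text \<open>The good words are the unimodal ones; a new minimum must be put at one of the two ends.\<close>

lemma catalytic_213_312:
  "catalytic q (triple_avoidance.first_sum (\<lambda>a b c. p213 a b c \<or> p312 a b c) q)"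
proof -
  interpret triple_avoidance "\<lambda>a b c. p213 a b c \<or> p312 a b c" q
    by (rule triple_avoidance_patterns(5))
  show ?thesis
  proof (rule catalytic_first_sum_insert_min)
    fix m :: nat and w :: "nat list"
    assume w: "w \<noteq> []" "distinct w" "\<And>x. x \<in> set w \<Longrightarrow> m < x" "good w"
    have "good (cs @ m # ds) \<longleftrightarrow> cs = [] \<or> ds = []" if cd: "cs @ ds = w" for cs ds
    proof -
      have gt: "m < x" if "x \<in> set cs \<union> set ds" for x using w(3) cd that by auto
      have "\<not> (p213 m b c \<or> p312 m b c)" if "subseq [b, c] ds" for b c
        using gt[of b] gt[of c] subseq_set[OF that] by (auto simp: pattern_defs)
      moreover have "\<not> (p213 a b m \<or> p312 a b m)" if "subseq [a, b] cs" for a b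
        using gt[of a] gt[of b] subseq_set[OF that] by (auto simp: pattern_defs)
      \<comment> \<open>Between two letters the new minimum is the bottom of a triple of type 213 or
        312, according to which of them is larger.\<close>
      moreover have "p213 a m c \<or> p312 a m c" if "a \<in> set cs" "c \<in> set ds" for a c
      proof -
        have "a \<noteq> c" using that w(2) cd by auto
        then show ?thesis using gt[of a] gt[of c] that by (auto simp: pattern_defs)
      qed
      ultimately show ?thesis
        unfolding good_append_Cons_iff cd using w(4) by (cases cs; cases ds) auto
    qed
    then have "\<forall>cs ds. cs @ ds = w \<longrightarrow> good (cs @ m # ds) \<longleftrightarrow> (cs, ds) = ([], w) \<or> (cs, ds) = (w, [])"
      by auto
    moreover have "desc ([] @ m # w) = desc w" "desc (w @ m # []) = Suc (desc w)"
      using w(1,3) desc_append_min[of "[]" w m] desc_append_min[of w "[]" m] by auto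
    ultimately show "\<exists>as bs as' bs'. as @ bs = w \<and> as' @ bs' = w \<and>
        desc (as @ m # bs) = desc w \<and> desc (as' @ m # bs') = Suc (desc w) \<and>
        (\<forall>cs ds. cs @ ds = w \<longrightarrow> good (cs @ m # ds) \<longleftrightarrow> (cs, ds) = (as, bs) \<or> (cs, ds) = (as', bs'))"
      by (intro exI[of _ "[]"] exI[of _ w]) (simp only: append.simps append_Nil2 simp_thms)
  qed
qed

text \<open>The good words first decrease and then increase; a new minimum must be put next to the old
  one.\<close>

lemma catalytic_132_231:
  "catalytic q (triple_avoidance.first_sum (\<lambda>a b c. p132 a b c \<or> p231 a b c) q)"
proof -
  interpret triple_avoidance "\<lambda>a b c. p132 a b c \<or> p231 a b c" q
    by (rule triple_avoidance_patterns(2))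
  \<comment> \<open>The new minimum is harmless in the middle of a triple. It ends one of type 231
    after an increasing pair in \<open>cs\<close> and starts one of type 132 before a decreasing
    pair in \<open>ds\<close>.\<close>
  have good_insert_min: "good (cs @ m # ds) \<longleftrightarrow> good (cs @ ds) \<and>
      (\<forall>a b. subseq [a, b] cs \<longrightarrow> b < a) \<and> (\<forall>b c. subseq [b, c] ds \<longrightarrow> b < c)"
    if dist: "distinct (cs @ ds)" and gt: "\<And>x. x \<in> set (cs @ ds) \<Longrightarrow> m < x" for m cs ds
  proof -
    have neq: "a \<noteq> b" if s: "subseq [a, b] xs" and d: "distinct xs" for a b :: nat and xs
    proof
      assume "a = b"
      then obtain N where "[b, b] = nths xs N" using s by (auto simp: subseq_conv_nths)
      then have "distinct [b, b]" using d by (metis distinct_nthsI)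
      then show False by simp
    qed
    have "\<not> (p132 m b c \<or> p231 m b c) \<longleftrightarrow> b < c" if "subseq [b, c] ds" for b c
      using gt[of b] gt[of c] subseq_set[OF that] neq[OF that] dist by (auto simp: pattern_defs)
    moreover have "\<not> (p132 a b m \<or> p231 a b m) \<longleftrightarrow> b < a" if "subseq [a, b] cs" for a b
      using gt[of a] gt[of b] subseq_set[OF that] neq[OF that] dist by (auto simp: pattern_defs)
    moreover have "\<not> (p132 a m c \<or> p231 a m c)" if "a \<in> set cs" "c \<in> set ds" for a c
      using gt[of a] gt[of c] that by (auto simp: pattern_defs)
    ultimately show ?thesis unfolding good_append_Cons_iff by blast
  qed
  show ?thesis
  proof (rule catalytic_first_sum_insert_min)
    fix m :: nat and w :: "nat list"
    assume w: "w \<noteq> []" "distinct w" "\<And>x. x \<in> set w \<Longrightarrow> m < x" "good w"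
    define v where "v = Min (set w)"
    have "v \<in> set w" using w(1) by (simp add: v_def)
    then obtain as bs where ab: "w = as @ v # bs" by (meson split_list)
    have gt: "v < x" if "x \<in> set as \<union> set bs" for x
    proof -
      have "x \<in> set w" using that ab by auto
      then have "v \<le> x" unfolding v_def by (rule Min_le[OF finite_set])
      moreover have "v \<noteq> x" using that ab w(2) by auto
      ultimately show ?thesis by simp
    qed
    have "m < v" using w(3) \<open>v \<in> set w\<close> .
    have dist: "distinct (as @ bs)" using w(2) ab by auto
    have as: "\<And>a b. subseq [a, b] as \<Longrightarrow> b < a" and bs: "\<And>b c. subseq [b, c] bs \<Longrightarrow> b < c"
    proof -
      have gt': "v < x" if "x \<in> set (as @ bs)" for x using gt[of x] that by simp
      have good: "good (as @ v # bs)" using w(4) ab by simp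
      \<comment> \<open>The old minimum \<open>v\<close> is itself a minimum inserted into
        \<open>as @ bs\<close>, so the criterion also describes \<open>w\<close>.\<close>
      note conds = iffD1[OF good_insert_min[OF dist gt'] good]
      show "b < a" if "subseq [a, b] as" for a b using conds that by blast
      show "b < c" if "subseq [b, c] bs" for b c using conds that by blast
    qed
    have iff: "good (cs @ m # ds) \<longleftrightarrow> (cs, ds) = (as, v # bs) \<or> (cs, ds) = (as @ [v], bs)"
      if cd: "cs @ ds = w" for cs ds
    proof -
      have *: "good (cs @ m # ds) \<longleftrightarrow>
          (\<forall>a b. subseq [a, b] cs \<longrightarrow> b < a) \<and> (\<forall>b c. subseq [b, c] ds \<longrightarrow> b < c)"
        using good_insert_min[of cs ds m, unfolded cd, OF w(2,3)] w(4) by blast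
      show ?thesis
      proof
        assume good: "good (cs @ m # ds)"
        have cs: "b < a" if "subseq [a, b] cs" for a b using good * that by blast
        have ds: "b < c" if "subseq [b, c] ds" for b c using good * that by blast
        from cd ab have "cs @ ds = as @ v # bs" by simp
        then consider us where "cs = as @ us" "us @ ds = v # bs" | us where "as = cs @ us" "ds = us @ v # bs"
          by (auto simp: append_eq_append_conv2)
        then show "(cs, ds) = (as, v # bs) \<or> (cs, ds) = (as @ [v], bs)"
        proof cases
          case 1
          show ?thesis
          proof (cases us)
            case (Cons y ys)
            then have us: "y = v" "bs = ys @ ds" using 1 by auto
            have "ys = []"
            proof (rule ccontr)
              assume "ys \<noteq> []"
              then obtain z zs where "ys = z # zs" by (cases ys) auto
              then have "subseq [v, z] cs" "v < z" using 1 Cons us gt[of z] by (auto intro: subseq_drop_many)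
              then show False using cs[of v z] by simp
            qed
            then show ?thesis using 1 Cons us by simp
          qed (use 1 in simp)
        next
          case 2
          show ?thesis
          proof (cases us)
            case (Cons y ys)
            have "subseq [y, v] ds" using 2 Cons by (simp add: subseq_singleton_left)
            moreover have "v < y" using 2 Cons gt[of y] by simp
            ultimately show ?thesis using ds[of y v] by simp
          qed (use 2 in simp)
        qed
      next
        assume "(cs, ds) = (as, v # bs) \<or> (cs, ds) = (as @ [v], bs)"
        then show "good (cs @ m # ds)"
        proof
          assume cd: "(cs, ds) = (as, v # bs)"
          have "b < c" if "subseq [b, c] (v # bs)" for b c
            using that bs[of b c] gt[of c] by (cases "b = v") (auto simp: subseq_singleton_left)
          then show ?thesis using * as cd by blast
        next
          assume cd: "(cs, ds) = (as @ [v], bs)"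
          have "b < a" if "subseq [a, b] (as @ [v])" for a b
            using that
          proof (cases rule: subseq_append_Cons_cases)
            case (2 us vs)
            then have "us = [a]" "b = v" by (auto simp: Cons_eq_append_conv)
            then show ?thesis using 2 gt[of a] by (simp add: subseq_singleton_left)
          qed (use as in simp)
          then show ?thesis using * bs cd by blast
        qed
      qed
    qed
    have dw: "desc w = desc as + (if as = [] then 0 else 1) + desc bs"
      unfolding ab using gt by (intro desc_append_min) auto
    have min: "m < x" if "x \<in> set as \<union> set bs \<union> {v}" for x using gt[of x] that \<open>m < v\<close> by auto
    \<comment> \<open>Before \<open>v\<close>, the letter \<open>m\<close> takes over the descent
      into \<open>v\<close>, if any; after \<open>v\<close> it adds a descent.\<close>
    have "desc (as @ m # v # bs) = desc w"
      unfolding dw using min gt desc_append_min[of as "v # bs" m] desc_append_min[of "[]" bs v] by auto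
    moreover have "desc ((as @ [v]) @ m # bs) = Suc (desc w)"
      unfolding dw using min gt desc_append_min[of "as @ [v]" bs m] desc_append_min[of as "[]" v] by auto
    ultimately show "\<exists>as bs as' bs'. as @ bs = w \<and> as' @ bs' = w \<and>
        desc (as @ m # bs) = desc w \<and> desc (as' @ m # bs') = Suc (desc w) \<and>
        (\<forall>cs ds. cs @ ds = w \<longrightarrow> good (cs @ m # ds) \<longleftrightarrow> (cs, ds) = (as, bs) \<or> (cs, ds) = (as', bs'))"
      using iff ab
      by (intro exI[of _ as] exI[of _ "v # bs"] exI[of _ "as @ [v]"] exI[of _ bs]) auto
  qed
qed

subsection \<open>Equidistribution\<close>

lemma contains_pattern_four:
  assumes "length \<rho> = 4"
  shows "contains_pattern p \<rho> \<longleftrightarrow>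
    (\<exists>z a b c. subseq [z, a, b, c] p \<and> order_isomorphic [z, a, b, c] \<rho>)"
proof -
  have "\<exists>z a b c. s = [z, a, b, c]" if "order_isomorphic s \<rho>" for s
  proof -
    have "length s = Suc (Suc (Suc (Suc 0)))" using that assms by (simp add: order_isomorphic_def)
    then show ?thesis unfolding length_Suc_conv by blast
  qed
  then show ?thesis unfolding contains_pattern_def by metis
qed

lemma order_isomorphic_patterns:
  "order_isomorphic [z, a, b, c] [1, 2, 4, 3] \<longleftrightarrow> z < a \<and> z < b \<and> z < c \<and> p132 a b c"
  "order_isomorphic [z, a, b, c] [1, 3, 2, 4] \<longleftrightarrow> z < a \<and> z < b \<and> z < c \<and> p213 a b c"
  "order_isomorphic [z, a, b, c] [1, 3, 4, 2] \<longleftrightarrow> z < a \<and> z < b \<and> z < c \<and> p231 a b c"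
  "order_isomorphic [z, a, b, c] [1, 4, 2, 3] \<longleftrightarrow> z < a \<and> z < b \<and> z < c \<and> p312 a b c"
  by (auto simp: order_isomorphic_def All_less_Suc pattern_defs)

lemma contains_pattern_iff:
  "contains_pattern p [1, 2, 4, 3] \<longleftrightarrow>
    (\<exists>z a b c. subseq [z, a, b, c] p \<and> z < a \<and> z < b \<and> z < c \<and> p132 a b c)"
  "contains_pattern p [1, 3, 2, 4] \<longleftrightarrow>
    (\<exists>z a b c. subseq [z, a, b, c] p \<and> z < a \<and> z < b \<and> z < c \<and> p213 a b c)"
  "contains_pattern p [1, 3, 4, 2] \<longleftrightarrow>
    (\<exists>z a b c. subseq [z, a, b, c] p \<and> z < a \<and> z < b \<and> z < c \<and> p231 a b c)"
  "contains_pattern p [1, 4, 2, 3] \<longleftrightarrow>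
    (\<exists>z a b c. subseq [z, a, b, c] p \<and> z < a \<and> z < b \<and> z < c \<and> p312 a b c)"
  by (simp_all add: contains_pattern_four order_isomorphic_patterns[simplified])

definition equidistributed :: "nat list \<Rightarrow> nat list \<Rightarrow> bool" where
  "equidistributed \<sigma> \<tau> \<longleftrightarrow> (\<forall>n\<ge>1.
     (\<Sum>\<pi>\<in>avoiding_permutations n \<sigma> \<tau>. var_q ^ desc \<pi> * var_v ^ hd \<pi>) =
     (\<Sum>e\<in>avoiding_inversion_sequences n. var_q ^ (dist_values e - 1) * var_v ^ last e))"

lemma equidistributed_commute: "equidistributed \<sigma> \<tau> \<longleftrightarrow> equidistributed \<tau> \<sigma>"
proof -
  have "avoiding_permutations n \<sigma> \<tau> = avoiding_permutations n \<tau> \<sigma>" for n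
    by (auto simp: avoiding_permutations_def)
  then show ?thesis by (simp add: equidistributed_def)
qed

text \<open>Both sides are expanded in powers of \<open>var_v\<close>. Their coefficients satisfy
  the same recurrence in \<open>var_q\<close>, so \<open>catalytic_unique\<close> identifies
  them.\<close>

lemma equidistributedI:
  assumes R: "triple_avoidance R"
    and cat: "catalytic var_q (triple_avoidance.first_sum R var_q)"
    and avoid: "\<And>p. contains_pattern p \<sigma> \<or> contains_pattern p \<tau> \<longleftrightarrow>
      (\<exists>z a b c. subseq [z, a, b, c] p \<and> z < a \<and> z < b \<and> z < c \<and> R a b c)"
  shows "equidistributed \<sigma> \<tau>"
proof -
  interpret triple_avoidance R var_q by (rule R)
  have "avoiding_permutations n \<sigma> \<tau> = perms n" for n
    unfolding avoiding_permutations_def perms_def using avoid by blast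
  moreover have "first_sum n m = inv_last var_q n m n" if "1 \<le> m" "m \<le> n" for n m
    using catalytic_unique[OF cat catalytic_inv_last that] .
  ultimately show ?thesis
    unfolding equidistributed_def by (simp add: sum_desc_hd_perms sum_dist_last[simplified])
qed

lemma equidistributed_patterns:
  "equidistributed [1, 2, 4, 3] [1, 3, 2, 4]"
  "equidistributed [1, 2, 4, 3] [1, 3, 4, 2]"
  "equidistributed [1, 2, 4, 3] [1, 4, 2, 3]"
  "equidistributed [1, 3, 2, 4] [1, 3, 4, 2]"
  "equidistributed [1, 3, 2, 4] [1, 4, 2, 3]"
  "equidistributed [1, 3, 4, 2] [1, 4, 2, 3]"
proof -
  show "equidistributed [1, 2, 4, 3] [1, 3, 2, 4]"
    by (rule equidistributedI[OF triple_avoidance_patterns(1) catalytic_132_213])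
      (unfold contains_pattern_iff, blast)
  show "equidistributed [1, 2, 4, 3] [1, 3, 4, 2]"
    by (rule equidistributedI[OF triple_avoidance_patterns(2) catalytic_132_231])
      (unfold contains_pattern_iff, blast)
  show "equidistributed [1, 2, 4, 3] [1, 4, 2, 3]"
    by (rule equidistributedI[OF triple_avoidance_patterns(3) catalytic_132_312])
      (unfold contains_pattern_iff, blast)
  show "equidistributed [1, 3, 2, 4] [1, 3, 4, 2]"
    by (rule equidistributedI[OF triple_avoidance_patterns(4) catalytic_213_231])
      (unfold contains_pattern_iff, blast)
  show "equidistributed [1, 3, 2, 4] [1, 4, 2, 3]"
    by (rule equidistributedI[OF triple_avoidance_patterns(5) catalytic_213_312])
      (unfold contains_pattern_iff, blast)
  show "equidistributed [1, 3, 4, 2] [1, 4, 2, 3]"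
    by (rule equidistributedI[OF triple_avoidance_patterns(6) catalytic_231_312])
      (unfold contains_pattern_iff, blast)
qed

section \<open>Necessity: patterns and permutations of equal length\<close>

lemma order_isomorphic_permutations:
  assumes iso: "order_isomorphic xs ys"
    and "xs \<in> permutations_of_set {1..n}" "ys \<in> permutations_of_set {1..n}"
  shows "xs = ys"
proof -
  \<comment> \<open>An entry of a permutation of \<open>{1..n}\<close> is its own rank, and an order
    isomorphism preserves ranks.\<close>
  have rank: "zs ! i = card {j. j < length zs \<and> zs ! j < zs ! i} + 1"
    if zs: "zs \<in> permutations_of_set {1..n}" and i: "i < length zs" for zs i
  proof -
    have img: "(\<lambda>j. zs ! j) ` {j. j < length zs \<and> zs ! j < zs ! i} = {x \<in> set zs. x < zs ! i}"
      by (auto simp: in_set_conv_nth)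
    have "inj_on (\<lambda>j. zs ! j) {j. j < length zs \<and> zs ! j < zs ! i}"
      using zs by (auto simp: inj_on_def permutations_of_set_def nth_eq_iff_index_eq)
    then have "card {j. j < length zs \<and> zs ! j < zs ! i} = card {x \<in> set zs. x < zs ! i}"
      unfolding img[symmetric] by (rule card_image[symmetric])
    moreover have "zs ! i \<in> {1..n}" using zs i by (auto simp: permutations_of_set_def)
    then have "{x \<in> set zs. x < zs ! i} = {1..<zs ! i}"
      using zs by (auto simp: permutations_of_set_def)
    ultimately show ?thesis using \<open>zs ! i \<in> {1..n}\<close> by simp
  qed
  have len: "length xs = length ys" using iso by (simp add: order_isomorphic_def)
  show ?thesis
  proof (rule nth_equalityI[OF len])
    fix i assume i: "i < length xs"
    have "{j. j < length xs \<and> xs ! j < xs ! i} = {j. j < length ys \<and> ys ! j < ys ! i}"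
      using iso i by (auto simp: order_isomorphic_def)
    then show "xs ! i = ys ! i" using rank[OF assms(2), of i] rank[OF assms(3), of i] i len by simp
  qed
qed

lemma contains_pattern_same_length:
  assumes "p \<in> permutations_of_set {1..n}" "\<sigma> \<in> permutations_of_set {1..n}"
  shows "contains_pattern p \<sigma> \<longleftrightarrow> p = \<sigma>"
proof
  assume "contains_pattern p \<sigma>"
  then obtain s where s: "subseq s p" "order_isomorphic s \<sigma>" by (auto simp: contains_pattern_def)
  have "length s = length p"
    using s(2) assms by (simp add: order_isomorphic_def length_finite_permutations_of_set)
  then have "s = p" using s(1) subseq_same_length by blast
  then show "p = \<sigma>" using order_isomorphic_permutations s(2) assms by blast
qed (auto simp: contains_pattern_def order_isomorphic_def)

text \<open>A permutation as long as a pattern contains it only by being equal to it, so avoidance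
  removes exactly two terms.\<close>

lemma sum_avoiding_permutations_same_length:
  fixes g :: "nat list \<Rightarrow> 'a::ab_group_add"
  assumes "\<sigma> \<in> permutations_of_set {1..n}" "\<tau> \<in> permutations_of_set {1..n}" "\<sigma> \<noteq> \<tau>"
  shows "sum g (permutations_of_set {1..n}) = sum g (avoiding_permutations n \<sigma> \<tau>) + (g \<sigma> + g \<tau>)"
proof -
  have "avoiding_permutations n \<sigma> \<tau> = permutations_of_set {1..n} - {\<sigma>, \<tau>}"
    using contains_pattern_same_length assms unfolding avoiding_permutations_def by blast
  then show ?thesis
    using sum.subset_diff[of "{\<sigma>, \<tau>}" "permutations_of_set {1..n}" g] assms by simp
qed

lemma var_q_var_v: "var_q ^ a * var_v ^ b = monom (monom 1 b) a"
proof -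
  have "var_v ^ b = [:monom 1 b:]"
    by (induction b) (simp_all add: var_v_def mult_monom one_pCons monom_0)
  moreover have "var_q ^ a = monom 1 a"
    by (induction a) (simp_all add: var_q_def mult_monom one_pCons monom_0)
  ultimately show ?thesis by (simp add: smult_monom)
qed

text \<open>The coefficient of \<open>q^i v^j\<close> is \<open>2\<close> on the right, while each
  monomial on the left contributes at most \<open>1\<close>.\<close>

lemma monomials_eq_two:
  assumes "var_q ^ a * var_v ^ b + var_q ^ c * var_v ^ d = var_q ^ i * var_v ^ j + var_q ^ i * var_v ^ j"
  shows "a = i \<and> b = j \<and> c = i \<and> d = j"
proof -
  have "coeff (coeff (var_q ^ a * var_v ^ b + var_q ^ c * var_v ^ d) i) j = 2"
    unfolding assms unfolding var_q_var_v coeff_add by simp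
  then show ?thesis unfolding var_q_var_v coeff_add by (auto split: if_splits)
qed

lemma permutations_four_desc_one:
  assumes "\<sigma> \<in> permutations_of_set {1..4}" "desc \<sigma> = 1" "hd \<sigma> = 1"
  shows "\<sigma> \<in> {[1,2,4,3], [1,3,2,4], [1,3,4,2], [1,4,2,3]}"
proof -
  have "length \<sigma> = 4" using assms(1) by (simp add: length_finite_permutations_of_set)
  then obtain a b c where \<sigma>: "\<sigma> = [1, a, b, c]"
    using assms(3) by (auto simp: numeral_eq_Suc length_Suc_conv)
  have "set \<sigma> = {1..4}" and dist: "distinct \<sigma>" using assms(1) by (simp_all add: permutations_of_set_def)
  moreover have "{1..4} = {1, 2, 3, 4::nat}" by auto
  ultimately have "set \<sigma> \<subseteq> {1, 2, 3, 4}" by simp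
  then have "a \<in> {1, 2, 3, 4}" "b \<in> {1, 2, 3, 4}" "c \<in> {1, 2, 3, 4}"
    unfolding \<sigma> by simp_all
  then show ?thesis using dist assms(2) unfolding \<sigma> by (auto simp: desc_Cons)
qed

theorem theorem1:
  fixes \<sigma> \<tau> :: "nat list"
  assumes "\<sigma> \<in> permutations_of_set {1..4}"
    and "\<tau> \<in> permutations_of_set {1..4}"
    and "\<sigma> \<noteq> \<tau>"
  shows "(\<forall>n\<ge>1.
            (\<Sum>\<pi>\<in>avoiding_permutations n \<sigma> \<tau>. var_q ^ desc \<pi> * var_v ^ hd \<pi>) =
            (\<Sum>e\<in>avoiding_inversion_sequences n. var_q ^ (dist_values e - 1) * var_v ^ last e))
         \<longleftrightarrow>
         {\<sigma>, \<tau>} \<in>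
           {{[1,2,4,3], [1,3,2,4]},
            {[1,2,4,3], [1,3,4,2]},
            {[1,2,4,3], [1,4,2,3]},
            {[1,3,2,4], [1,3,4,2]},
            {[1,3,2,4], [1,4,2,3]},
            {[1,3,4,2], [1,4,2,3]}}"
  unfolding equidistributed_def[symmetric]
proof
  assume "equidistributed \<sigma> \<tau>"
  define g :: "nat list \<Rightarrow> int poly poly" where "g \<pi> = var_q ^ desc \<pi> * var_v ^ hd \<pi>" for \<pi>
  \<comment> \<open>A pair already known to be equidistributed serves as reference. Comparing with
    it at length four replaces an evaluation of the sum over inversion sequences.\<close>
  define \<alpha> \<beta> :: "nat list" where "\<alpha> = [1,2,4,3]" and "\<beta> = [1,3,2,4]"
  have mem: "\<alpha> \<in> permutations_of_set {1..4}" "\<beta> \<in> permutations_of_set {1..4}" "\<alpha> \<noteq> \<beta>"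
    by (auto simp: \<alpha>_def \<beta>_def permutations_of_set_def)
  have "sum g (avoiding_permutations 4 \<sigma> \<tau>) = sum g (avoiding_permutations 4 \<alpha> \<beta>)"
    using \<open>equidistributed \<sigma> \<tau>\<close> equidistributed_patterns(1)
    by (simp add: equidistributed_def g_def \<alpha>_def \<beta>_def)
  then have "g \<sigma> + g \<tau> = g \<alpha> + g \<beta>"
    using sum_avoiding_permutations_same_length[OF assms, of g]
      sum_avoiding_permutations_same_length[OF mem, of g] by simp
  moreover have "g \<alpha> = var_q ^ 1 * var_v ^ 1" "g \<beta> = var_q ^ 1 * var_v ^ 1"
    by (simp_all add: g_def \<alpha>_def \<beta>_def desc_Cons)
  ultimately have "desc \<sigma> = 1 \<and> hd \<sigma> = 1 \<and> desc \<tau> = 1 \<and> hd \<tau> = 1"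
    unfolding g_def by (intro monomials_eq_two) simp
  then show "{\<sigma>, \<tau>} \<in>
           {{[1,2,4,3], [1,3,2,4]},
            {[1,2,4,3], [1,3,4,2]},
            {[1,2,4,3], [1,4,2,3]},
            {[1,3,2,4], [1,3,4,2]},
            {[1,3,2,4], [1,4,2,3]},
            {[1,3,4,2], [1,4,2,3]}}"
    using permutations_four_desc_one[OF assms(1)] permutations_four_desc_one[OF assms(2)] assms(3)
    unfolding insert_iff empty_iff doubleton_eq_iff by (elim conjE) metis
next
  assume "{\<sigma>, \<tau>} \<in>
           {{[1,2,4,3], [1,3,2,4]},
            {[1,2,4,3], [1,3,4,2]},
            {[1,2,4,3], [1,4,2,3]},
            {[1,3,2,4], [1,3,4,2]},
            {[1,3,2,4], [1,4,2,3]},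
            {[1,3,4,2], [1,4,2,3]}}"
  then show "equidistributed \<sigma> \<tau>"
    using equidistributed_patterns equidistributed_patterns[THEN equidistributed_commute[THEN iffD1]]
    unfolding insert_iff empty_iff doubleton_eq_iff by blast
qed

end
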